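(* Let $G$ be a digraph with vertex set $\{1,2,\dots,n\}$, let $H_1,\dots,H_n$ be digraphs, and let $\overrightarrow{G}=G[H_1,H_2,\dots,H_n]$ be their generalized join digraph with respect to $G$. Put $m_i=|V(H_i)|$ for $1\le i\le n$. Then $$t(\overrightarrow{G})=\prod_{i\in V(G)}\prod_{k=1}^{m_i-1}\left(\mu_k(H_i)+\sum_{j:\,(i,j)\in E(G)}m_j\right)\cdot\sum_{T\in\mathcal{T}(G)}\ \prod_{(i,j)\in E(T)}m_j .$$
   Context: Digraphs are finite, with nonempty vertex set, without loops or multiple edges (both $(u,v)$ and $(v,u)$ may be edges); $(u,v)$ is an edge directed from tail $u$ to head $v$. Generalized join digraph: $G[H_1,\dots,H_n]$ is obtained from $G$ by replacing each vertex $i$ with $H_i$: its vertex set is the disjoint union $V(H_1)\cup\dots\cup V(H_n)$, the edges inside each $H_i$ are kept, and for $i\ne j$, $u\in V(H_i)$, $v\in V(H_j)$, $(u,v)$ is an edge if and only if $(i,j)\in E(G)$. Oriented spanning tree: an oriented spanning tree of a digraph is a subtree containing all its vertices, in which one vertex, the root, has outdegree $0$ and every other vertex has outdegree $1$ (so all edges point towards the root). $\mathcal{T}(G)$ is the set of all oriented spanning trees of $G$, and $t(G)=|\mathcal{T}(G)|$. Laplacian: for an unweighted digraph $H$, $L_H$ is the matrix with $(L_H)_{uu}=$ the outdegree of $u$, $(L_H)_{uv}=-1$ if $(u,v)\in E(H)$, and $0$ otherwise. The Laplacian eigenvalues $\mu_1(H),\dots,\mu_m(H)$ ($m=|V(H)|$)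 are the complex eigenvalues of $L_H$ with algebraic multiplicity; since all row sums of $L_H$ are $0$, $0$ is an eigenvalue, and the numbering is such that $\mu_m(H)=0$. Empty products equal $1$. *)

theory Defs
  imports
    "Graph_Theory.Digraph_Component"
    "Jordan_Normal_Form.Char_Poly"
    Complex_Main
begin

text \<open>\<^const>\<open>pair_digraph\<close> provides finiteness and absence of loops, but allows an empty vertex set.\<close>

definition nonempty_digraph :: "'a pair_pre_digraph \<Rightarrow> bool" where
  "nonempty_digraph D \<longleftrightarrow> pair_digraph D \<and> pverts D \<noteq> {}"

text \<open>The vertices are tagged with their index to make the union disjoint.\<close>

definition generalized_join ::
    "'a pair_pre_digraph \<Rightarrow> ('a \<Rightarrow> 'b pair_pre_digraph) \<Rightarrow> ('a \<times> 'b) pair_pre_digraph" where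
  "generalized_join G H = \<lparr>
     pverts = Sigma (pverts G) (\<lambda>i. pverts (H i)),
     parcs = {((i, u), (i, v)) | i u v. i \<in> pverts G \<and> (u, v) \<in> parcs (H i)}
           \<union> {((i, u), (j, v)) | i j u v. i \<in> pverts G \<and> j \<in> pverts G \<and> i \<noteq> j \<and>
                u \<in> pverts (H i) \<and> v \<in> pverts (H j) \<and> (i, j) \<in> parcs G}\<rparr>"

text \<open>
  The library predicate \<^const>\<open>tree\<close> only excludes directed cycles, so a transitive tournament
  satisfies it. Here the underlying undirected multigraph is required to be a tree:
  \<^const>\<open>asym\<close> excludes loops and pairs of opposite edges (undirected cycles of length 1 and 2),
  and in the symmetric closure the directed cycles of length at least 3 are exactly the
  undirected ones (those of length 2 just traverse one edge back and forth).
\<close>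

definition undirected_tree :: "'a pair_pre_digraph \<Rightarrow> bool" where
  "undirected_tree T \<longleftrightarrow>
     Digraph_Component.connected (with_proj T) \<and>
     asym (parcs T) \<and>
     \<not> (\<exists>p. pre_digraph.cycle (with_proj (mk_symmetric (with_proj T))) p \<and> length p \<ge> 3)"

definition oriented_spanning_trees :: "'a pair_pre_digraph \<Rightarrow> 'a pair_pre_digraph set" where
  "oriented_spanning_trees G = {T.
     spanning (with_proj T) (with_proj G) \<and> undirected_tree T \<and>
     (\<exists>r \<in> pverts T. out_degree (with_proj T) r = 0 \<and>
        (\<forall>v \<in> pverts T - {r}. out_degree (with_proj T) v = 1))}"

definition num_oriented_spanning_trees :: "'a pair_pre_digraph \<Rightarrow> nat" where
  "num_oriented_spanning_trees G = card (oriented_spanning_trees G)"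

text \<open>The list \<open>vs\<close> enumerates the vertices; it fixes the order of rows and columns.\<close>

definition laplacian_mat :: "'a pair_pre_digraph \<Rightarrow> 'a list \<Rightarrow> complex mat" where
  "laplacian_mat D vs = mat (length vs) (length vs) (\<lambda>(i, j).
     if i = j then of_nat (out_degree (with_proj D) (vs ! i))
     else if (vs ! i, vs ! j) \<in> parcs D then -1 else 0)"

text \<open>
  \<open>\<mu> 1, \<dots>, \<mu> m\<close> with \<open>m = card (pverts D)\<close> lists the Laplacian eigenvalues with algebraic
  multiplicity. The characteristic polynomial does not depend on the enumeration \<open>vs\<close>.
\<close>

definition laplacian_eigenvalues :: "'a pair_pre_digraph \<Rightarrow> (nat \<Rightarrow> complex) \<Rightarrow> bool" where
  "laplacian_eigenvalues D \<mu> \<longleftrightarrow>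
     (\<exists>vs. distinct vs \<and> set vs = pverts D \<and>
        char_poly (laplacian_mat D vs) = (\<Prod>k = 1..card (pverts D). [:- \<mu> k, 1:]))"

end

(*
  Expanding det (x I + L) row by row gives a sum over functions assigning to every vertex either the
  head of an arc or "root"; the determinant of the 0/1/-1 matrix of such a function is 1 if it is a
  rooted forest and 0 otherwise. Hence det (x I + L) / x tends to the (weighted) number of oriented
  spanning trees as x tends to 0.
  For the join, the blocks H_i form an equitable partition of x I + L. So the determinant is that of
  the quotient, which is x I + L for G with weights m_j, times one factor for each block. Applying the
  same factorization to x + d_i + L(H_i), where d_i is the sum of m_j over the arcs (i, j), identifies
  the block factor as the characteristic polynomial of H_i without its root mu = 0, and it remains to
  divide by x and let x tend to 0.
*)
theory Submission
  imports Defs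
begin

section \<open>Determinants of matrices indexed by lists\<close>

text \<open>The variable x cannot simply be set to 0. There the rows of L sum to 0, so the
  determinant vanishes, and the factor of the block H_i is only reached by cancelling x + d_i, where
  d_i = 0 if i has no outgoing arc in G. Hence the factorization is proved for complex x different
  from every -d_i, and the result is carried to x = 0 by continuity. Dividing by x treats all roots
  alike: a forest with k roots contributes a multiple of x^k, so k = 1 is what remains in the limit.
  The matrix-tree theorem is weighted because it serves two digraphs: the join with weight 1 on each
  arc, and G with weight m_j on (i, j), which is the number of arcs from one vertex of H_i into H_j.
  Forests are described by a natural-valued depth that drops along every arc. The same depth
  evaluates determinants, excludes undirected cycles and drives the induction for
  connectedness.\<close>

definition list_mat :: "'a list \<Rightarrow> 'b list \<Rightarrow> ('a \<Rightarrow> 'b \<Rightarrow> 'c) \<Rightarrow> 'c mat" where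
  "list_mat xs ys A = mat (length xs) (length ys) (\<lambda>(a, b). A (xs ! a) (ys ! b))"

lemma list_mat_carrier [simp]: "list_mat xs ys A \<in> carrier_mat (length xs) (length ys)"
  by (simp add: list_mat_def)

lemma list_mat_dim [simp]:
  "dim_row (list_mat xs ys A) = length xs" "dim_col (list_mat xs ys A) = length ys"
  by (simp_all add: list_mat_def)

lemma list_mat_cong:
  assumes "\<And>u v. u \<in> set xs \<Longrightarrow> v \<in> set ys \<Longrightarrow> A u v = B u v"
  shows "list_mat xs ys A = list_mat xs ys B"
  by (rule eq_matI) (auto simp: list_mat_def assms)

lemma list_mat_map: "list_mat (map f xs) (map g ys) A = list_mat xs ys (\<lambda>u v. A (f u) (g v))"
  by (rule eq_matI) (auto simp: list_mat_def)

lemma list_mat_append: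
  "list_mat (xs @ xs') (ys @ ys') A =
   four_block_mat (list_mat xs ys A) (list_mat xs ys' A) (list_mat xs' ys A) (list_mat xs' ys' A)"
  by (rule eq_matI) (auto simp: list_mat_def nth_append)

lemma list_mat_mult:
  fixes A :: "'a \<Rightarrow> 'b \<Rightarrow> 'c :: comm_semiring_0"
  assumes "distinct ys"
  shows "list_mat xs ys A * list_mat ys zs B = list_mat xs zs (\<lambda>u w. \<Sum>v\<in>set ys. A u v * B v w)"
proof -
  have "(\<Sum>v\<in>set ys. h v) = (\<Sum>k = 0..<length ys. h (ys ! k))" for h :: "'b \<Rightarrow> 'c"
    using sum_list_distinct_conv_sum_set[OF assms, of h]
    by (simp add: sum_list_sum_nth)
  then show ?thesis
    by (intro eq_matI) (auto simp: list_mat_def scalar_prod_def)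
qed

lemma list_mat_add: "list_mat xs ys A + list_mat xs ys B = list_mat xs ys (\<lambda>u v. A u v + B u v)"
  by (rule eq_matI) (auto simp: list_mat_def)

lemma list_mat_diff: "list_mat xs ys A - list_mat xs ys B = list_mat xs ys (\<lambda>u v. A u v - B u v)"
  by (rule eq_matI) (auto simp: list_mat_def)

text \<open>Entries are functions of vertices and the list only fixes an order. Submatrices are then
  sublists, and blocks of the join are images of lists under \<open>Pair i\<close>.\<close>

definition list_det :: "'a list \<Rightarrow> ('a \<Rightarrow> 'a \<Rightarrow> 'c :: comm_ring_1) \<Rightarrow> 'c" where
  "list_det xs A = det (list_mat xs xs A)"

lemma list_det_cong:
  assumes "\<And>u v. u \<in> set xs \<Longrightarrow> v \<in> set xs \<Longrightarrow> A u v = B u v"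
  shows "list_det xs A = list_det xs B"
proof -
  have "list_mat xs xs A = list_mat xs xs B"
    by (rule list_mat_cong) (rule assms)
  then show ?thesis by (simp add: list_det_def)
qed

lemma list_det_map: "list_det (map f xs) A = list_det xs (\<lambda>u v. A (f u) (f v))"
  by (simp add: list_det_def list_mat_map)

lemma list_det_append:
  fixes A :: "'a \<Rightarrow> 'a \<Rightarrow> 'c :: idom"
  assumes "\<And>u v. u \<in> set ys \<Longrightarrow> v \<in> set xs \<Longrightarrow> A u v = 0"
  shows "list_det (xs @ ys) A = list_det xs A * list_det ys A"
  unfolding list_det_def list_mat_append
proof (rule det_four_block_mat_lower_left_zero)
  show "list_mat ys xs A = 0\<^sub>m (length ys) (length xs)"
    by (rule eq_matI) (auto simp: list_mat_def assms)
qed simp_all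

text \<open>Splitting off one block at a time leaves a block triangular matrix; the empty matrix has
  determinant 1.\<close>

lemma list_det_concat:
  fixes A :: "'a \<Rightarrow> 'a \<Rightarrow> 'c :: idom"
  assumes "distinct js"
    and "\<And>i j u v. i \<in> set js \<Longrightarrow> j \<in> set js \<Longrightarrow> i \<noteq> j \<Longrightarrow> u \<in> set (f i) \<Longrightarrow> v \<in> set (f j) \<Longrightarrow> A u v = 0"
  shows "list_det (concat (map f js)) A = (\<Prod>i\<in>set js. list_det (f i) A)"
  using assms
proof (induction "js")
  case Nil
  then show ?case by (simp add: list_det_def det_def list_mat_def)
next
  case (Cons i js)
  have "list_det (f i @ concat (map f js)) A = list_det (f i) A * list_det (concat (map f js)) A"
    by (rule list_det_append) (use Cons.prems in fastforce)
  moreover have "list_det (concat (map f js)) A = (\<Prod>i\<in>set js. list_det (f i) A)"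
    by (rule Cons.IH) (use Cons.prems in auto)
  ultimately show ?case
    using Cons.prems(1) by simp
qed

lemma list_det_singleton [simp]: "list_det [a] A = A a a"
  by (simp add: list_det_def list_mat_def det_single)

section \<open>Elimination along an equitable partition\<close>

text \<open>The matrix is conjugated by the block matrix with rows \<open>(1, 0)\<close> and \<open>(P, 1)\<close>.\<close>

lemma det_similar_four_block:
  fixes A :: "'c :: idom mat"
  assumes [simp]: "A \<in> carrier_mat k k" "B \<in> carrier_mat k l" "C \<in> carrier_mat l k"
      "D \<in> carrier_mat l l" "P \<in> carrier_mat l k"
    and eq: "C + D * P = P * (A + B * P)"
  shows "det (four_block_mat A B C D) = det (A + B * P) * det (D - P * B)"
proof -
  let ?M = "four_block_mat A B C D"
  let ?E = "four_block_mat (1\<^sub>m k) (0\<^sub>m k l) P (1\<^sub>m l)"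
  let ?N = "four_block_mat (A + B * P) B (0\<^sub>m l k) (D - P * B)"
  have car: "?M \<in> carrier_mat (k + l) (k + l)" "?E \<in> carrier_mat (k + l) (k + l)"
      "?N \<in> carrier_mat (k + l) (k + l)"
    by (auto intro!: four_block_carrier_mat minus_carrier_mat add_carrier_mat mult_carrier_mat[of _ k l] mult_carrier_mat[of _ l k])
  have detE: "det ?E = 1"
    by (subst det_four_block_mat_upper_right_zero[of _ k _ l]) auto
  \<comment> \<open>Both \<open>?M * ?E\<close> and \<open>?E * ?N\<close> are computed; they differ
    only in the lower left block, where \<open>eq\<close> identifies them. So \<open>?M\<close> is
    similar to the block triangular \<open>?N\<close>.\<close>
  have ME: "?M * ?E = four_block_mat (A + B * P) B (C + D * P) D"
    by (subst mult_four_block_mat[of _ k k _ l _ l _ _ k _ l])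
      (auto intro!: cong_four_block_mat simp: assms(1-4)[THEN right_mult_one_mat]
        assms(1,3)[THEN right_mult_zero_mat] assms(2,4)[THEN left_add_zero_mat])
  have [simp]: "A + B * P \<in> carrier_mat k k" "D - P * B \<in> carrier_mat l l" "P * B \<in> carrier_mat l l"
      "P * (A + B * P) \<in> carrier_mat l k"
    using assms(1-5) by (auto intro!: minus_carrier_mat add_carrier_mat
        mult_carrier_mat[of _ k l] mult_carrier_mat[of _ l k] mult_carrier_mat[of _ l k _ k])
  have "X + (D - X) = D" if "X \<in> carrier_mat l l" for X
    using that carrier_matD[OF assms(4)] by (intro eq_matI) auto
  from this[of "P * B"] have EN: "?E * ?N = four_block_mat (A + B * P) B (P * (A + B * P)) D"
    by (subst mult_four_block_mat[of _ k k _ l _ l _ _ k _ l])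
      (auto intro!: cong_four_block_mat simp: left_mult_one_mat[of _ l l] left_mult_one_mat[of _ k l]
        left_mult_one_mat[of _ k k] right_add_zero_mat[of _ k k] right_add_zero_mat[of _ l k]
        left_mult_zero_mat[of _ l l] right_add_zero_mat[of _ k l])
  have "det ?M * det ?E = det (?M * ?E)"
    by (rule det_mult[OF car(1,2), symmetric])
  also have "?M * ?E = ?E * ?N"
    unfolding ME EN eq ..
  also have "det (?E * ?N) = det ?E * det ?N"
    by (rule det_mult[OF car(2,3)])
  also have "det ?N = det (A + B * P) * det (D - P * B)"
    by (rule det_four_block_mat_lower_left_zero) (auto simp: minus_carrier_mat)
  finally show ?thesis
    by (simp add: detE)
qed

text \<open>
  An equitable partition: \<open>\<rho>\<close> maps every index to the representative of its class, and the sum of a row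
  over a class depends only on the class of the row.
\<close>

lemma list_det_equitable:
  fixes M :: "'a \<Rightarrow> 'a \<Rightarrow> 'c :: idom" and \<rho> :: "'a \<Rightarrow> 'a"
  assumes dist: "distinct (rs @ ts)"
    and rep: "\<And>v. v \<in> set ts \<Longrightarrow> \<rho> v \<in> set rs" "\<And>r. r \<in> set rs \<Longrightarrow> \<rho> r = r"
    and equitable: "\<And>t r. t \<in> set ts \<Longrightarrow> r \<in> set rs \<Longrightarrow>
      (\<Sum>v | v \<in> set (rs @ ts) \<and> \<rho> v = r. M t v) = (\<Sum>v | v \<in> set (rs @ ts) \<and> \<rho> v = r. M (\<rho> t) v)"
  shows "list_det (rs @ ts) M =
    list_det rs (\<lambda>u r. \<Sum>v | v \<in> set (rs @ ts) \<and> \<rho> v = r. M u v) *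
    list_det ts (\<lambda>u v. M u v - M (\<rho> u) v)"
proof -
  \<comment> \<open>\<open>P\<close> is the class membership matrix of the non-representatives and
    \<open>Q\<close> collects row sums over classes, so on representatives \<open>Q\<close> is the
    quotient matrix.\<close>
  define P where "P = (\<lambda>v r. if \<rho> v = r then 1 else 0 :: 'c)"
  define Q where "Q = (\<lambda>u r. \<Sum>v | v \<in> set (rs @ ts) \<and> \<rho> v = r. M u v)"
  have dist': "distinct rs" "distinct ts" "set rs \<inter> set ts = {}"
    using dist by auto
  have Q: "M u r + (\<Sum>v\<in>set ts. M u v * P v r) = Q u r" if "r \<in> set rs" for u r
  proof -
    have "{v. v \<in> set (rs @ ts) \<and> \<rho> v = r} = insert r {v \<in> set ts. \<rho> v = r}"
      using rep that by auto
    moreover have "r \<notin> {v \<in> set ts. \<rho> v = r}"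
      using that dist' by auto
    moreover have "(\<Sum>v\<in>set ts. M u v * P v r) = (\<Sum>v\<in>{v \<in> set ts. \<rho> v = r}. M u v)"
      unfolding P_def by (subst sum.inter_filter) (auto intro!: sum.cong)
    ultimately show ?thesis
      by (simp add: Q_def)
  qed
  \<comment> \<open>Multiplying by \<open>P\<close> from the left replaces row \<open>t\<close> by
    the row of its representative.\<close>
  have PM: "(\<Sum>r\<in>set rs. P t r * F r) = F (\<rho> t)" if "t \<in> set ts" for t and F :: "'a \<Rightarrow> 'c"
    unfolding P_def using rep(1)[OF that] by (simp add: if_distrib[of "\<lambda>x. x * _"] cong: if_cong)
  have AQ: "list_mat rs rs M + list_mat rs ts M * list_mat ts rs P = list_mat rs rs Q"
    unfolding list_mat_mult[OF dist'(2)] list_mat_add by (rule list_mat_cong) (simp add: Q)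
  have CQ: "list_mat ts rs M + list_mat ts ts M * list_mat ts rs P = list_mat ts rs Q"
    unfolding list_mat_mult[OF dist'(2)] list_mat_add by (rule list_mat_cong) (simp add: Q)
  \<comment> \<open>This is where equitability enters: it is the intertwining condition of
    \<open>det_similar_four_block\<close>.\<close>
  have "list_mat ts rs P * list_mat rs rs Q = list_mat ts rs Q"
    unfolding list_mat_mult[OF dist'(1)]
    by (rule list_mat_cong) (use equitable in \<open>simp add: PM Q_def\<close>)
  then have "det (four_block_mat (list_mat rs rs M) (list_mat rs ts M) (list_mat ts rs M) (list_mat ts ts M))
    = det (list_mat rs rs Q) * det (list_mat ts ts M - list_mat ts rs P * list_mat rs ts M)"
    unfolding AQ[symmetric] using CQ
    by (intro det_similar_four_block[of _ "length rs" _ "length ts"]) (auto simp: AQ)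
  also have "list_mat ts ts M - list_mat ts rs P * list_mat rs ts M =
      list_mat ts ts (\<lambda>u v. M u v - M (\<rho> u) v)"
    unfolding list_mat_mult[OF dist'(1)] list_mat_diff by (rule list_mat_cong) (simp add: PM)
  finally show ?thesis
    unfolding list_det_def list_mat_append Q_def .
qed

text \<open>The characteristic polynomial is det (x I - L); at x = -s this is the determinant of -(s
  I + L), whence one sign per row.\<close>

lemma list_det_shift_char_poly:
  fixes L :: "'a \<Rightarrow> 'a \<Rightarrow> complex"
  assumes "distinct vs"
  shows "list_det vs (\<lambda>u v. (if u = v then s else 0) + L u v) =
    (-1) ^ length vs * poly (char_poly (list_mat vs vs L)) (- s)"
proof -
  let ?L = "list_mat vs vs L"
  have "poly (char_poly ?L) (- s) = det (- (char_matrix ?L (- s)))"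
    by (rule char_poly_matrix) (rule list_mat_carrier)
  also have "- (char_matrix ?L (- s)) = (-1) \<cdot>\<^sub>m list_mat vs vs (\<lambda>u v. (if u = v then s else 0) + L u v)"
    by (rule eq_matI) (use assms in \<open>auto simp: char_matrix_def list_mat_def nth_eq_iff_index_eq\<close>)
  also have "det \<dots> = (-1) ^ length vs * list_det vs (\<lambda>u v. (if u = v then s else 0) + L u v)"
    by (simp add: list_det_def)
  finally show ?thesis
    by (simp flip: mult.assoc power_mult_distrib)
qed

section \<open>Expansion over rooted forests\<close>

text \<open>\<open>f v\<close> is the head of the arc leaving \<open>v\<close>, and \<open>None\<close> at a root.\<close>

abbreviation parent_functions :: "'a set \<Rightarrow> ('a \<Rightarrow> 'a option) set" where
  "parent_functions V \<equiv> PiE V (\<lambda>_. insert None (Some ` V))"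

lemma parent_functionsD:
  assumes "f \<in> parent_functions V" "v \<in> V" "f v = Some w"
  shows "w \<in> V"
  using PiE_mem[OF assms(1,2)] assms(3) by auto

text \<open>Acyclicity of \<open>f\<close> is encoded by a depth, which later proofs can use at once
  for minima, maxima and induction. Several roots are allowed.\<close>

definition rooted_forest :: "'a set \<Rightarrow> ('a \<Rightarrow> 'a option) \<Rightarrow> bool" where
  "rooted_forest V f \<longleftrightarrow> (\<exists>d :: 'a \<Rightarrow> nat. \<forall>v\<in>V. \<forall>w. f v = Some w \<longrightarrow> d w < d v)"

text \<open>Follow \<open>f\<close> from each vertex. If every path ends, its length is a depth;
  otherwise the vertices with endless paths form \<open>S\<close>, and a vertex is one of them
  exactly if its parent is.\<close>

lemma rooted_forest_or_closed:
  assumes f: "\<And>v w. v \<in> V \<Longrightarrow> f v = Some w \<Longrightarrow> w \<in> V" and "\<not> rooted_forest V f"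
  obtains S where "S \<subseteq> V" "S \<noteq> {}" "\<And>v. v \<in> V \<Longrightarrow> v \<in> S \<longleftrightarrow> (\<exists>w\<in>S. f v = Some w)"
proof -
  \<comment> \<open>\<open>F\<close> extends \<open>f\<close> so that it can be iterated past a
    root: \<open>None\<close> is absorbing.\<close>
  define F where "F = (\<lambda>p. Option.bind p f)"
  have F_None: "(F ^^ k) None = None" for k
    by (induction k) (simp_all add: F_def)
  have step: "(F ^^ Suc k) (Some v) = (F ^^ k) (f v)" for k v
    by (simp add: funpow_Suc_right F_def del: funpow.simps)
  define S where "S = {v \<in> V. \<forall>k. (F ^^ k) (Some v) \<noteq> None}"
  have "S \<noteq> {}"
  proof
    assume "S = {}"
    then have ex: "\<exists>k. (F ^^ k) (Some v) = None" if "v \<in> V" for v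
      using that by (auto simp: S_def)
    define d where "d v = (LEAST k. (F ^^ k) (Some v) = None)" for v
    have "d w < d v" if "v \<in> V" "f v = Some w" for v w
    proof -
      have d: "(F ^^ d v) (Some v) = None"
        unfolding d_def by (rule LeastI_ex) (rule ex[OF \<open>v \<in> V\<close>])
      then obtain k where k: "d v = Suc k"
        by (cases "d v") auto
      have "(F ^^ k) (Some w) = None"
        using d that step[of k v] by (simp add: k del: funpow.simps)
      then show ?thesis
        using k unfolding d_def[of w] by (simp add: le_imp_less_Suc Least_le)
    qed
    then have "rooted_forest V f"
      unfolding rooted_forest_def by blast
    with assms(2) show False ..
  qed
  moreover have "v \<in> S \<longleftrightarrow> (\<exists>w\<in>S. f v = Some w)" if "v \<in> V" for v
  proof (cases "f v")
    case None
    then have "(F ^^ Suc 0) (Some v) = None"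
      by (simp add: F_def)
    then have "v \<notin> S"
      unfolding S_def by blast
    then show ?thesis
      using None by simp
  next
    case (Some w)
    \<comment> \<open>The case k = 0 on the left is trivial, so the index may be shifted by one step
      of \<open>f\<close>.\<close>
    have "(\<forall>k. (F ^^ k) (Some v) \<noteq> None) \<longleftrightarrow> (\<forall>k. (F ^^ Suc k) (Some v) \<noteq> None)"
      by (metis funpow_0 not0_implies_Suc option.distinct(1))
    then show ?thesis
      using that f[OF that Some] Some unfolding S_def step by simp
  qed
  ultimately show ?thesis
    using that[of S] by (auto simp: S_def)
qed

text \<open>A vertex of minimal depth cannot have a parent.\<close>

lemma rooted_forest_has_root:
  assumes "rooted_forest V f" "V \<noteq> {}" and f: "\<And>v w. v \<in> V \<Longrightarrow> f v = Some w \<Longrightarrow> w \<in> V"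
  shows "\<exists>v\<in>V. f v = None"
proof -
  obtain d :: "'a \<Rightarrow> nat" where d: "\<And>v w. v \<in> V \<Longrightarrow> f v = Some w \<Longrightarrow> d w < d v"
    using assms(1) by (auto simp: rooted_forest_def)
  obtain v where "v \<in> V" "\<And>w. w \<in> V \<Longrightarrow> d v \<le> d w"
    using ex_has_least_nat[of "\<lambda>v. v \<in> V" _ d] assms(2) by auto
  then have "f v = None"
    using d f by (metis leD option.exhaust)
  then show ?thesis
    using \<open>v \<in> V\<close> by blast
qed

text \<open>Row \<open>u\<close> is e_u - e_w if w is the parent of \<open>u\<close>, and e_u if
  \<open>u\<close> is a root: the Laplacian of the functional graph of \<open>f\<close> plus 1 on
  the diagonal at the roots.\<close>

definition parent_matrix :: "('a \<Rightarrow> 'a option) \<Rightarrow> 'a \<Rightarrow> 'a \<Rightarrow> 'c :: comm_ring_1" where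
  "parent_matrix f u v = of_bool (u = v) - of_bool (f u = Some v)"

text \<open>A permutation contributing to the determinant never increases the depth, so it is the identity.\<close>

lemma list_det_parent_matrix_forest:
  fixes f :: "'a \<Rightarrow> 'a option"
  assumes dist: "distinct vs" and "rooted_forest (set vs) f"
  shows "list_det vs (parent_matrix f) = (1 :: 'c :: comm_ring_1)"
proof -
  obtain d :: "'a \<Rightarrow> nat" where d: "\<And>v w. v \<in> set vs \<Longrightarrow> f v = Some w \<Longrightarrow> d w < d v"
    using assms(2) by (auto simp: rooted_forest_def)
  let ?I = "{0..<length vs}"
  let ?M = "parent_matrix f :: 'a \<Rightarrow> 'a \<Rightarrow> 'c"
  have zero: "(\<Prod>i\<in>?I. ?M (vs ! i) (vs ! p i)) = 0" if p: "p permutes ?I" and "p \<noteq> id" for p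
  proof (rule ccontr)
    assume nz: "(\<Prod>i\<in>?I. ?M (vs ! i) (vs ! p i)) \<noteq> 0"
    have le: "d (vs ! p i) \<le> d (vs ! i)" and lt: "p i \<noteq> i \<Longrightarrow> d (vs ! p i) < d (vs ! i)"
      if i: "i \<in> ?I" for i
    proof -
      have "?M (vs ! i) (vs ! p i) \<noteq> 0"
        using nz i by (metis prod_zero finite_atLeastLessThan)
      moreover have "p i < length vs"
        using permutes_in_image[OF p, of i] i by simp
      ultimately have "p i = i \<or> f (vs ! i) = Some (vs ! p i)"
        using i dist by (auto simp: parent_matrix_def nth_eq_iff_index_eq split: if_splits)
      then show "d (vs ! p i) \<le> d (vs ! i)" "p i \<noteq> i \<Longrightarrow> d (vs ! p i) < d (vs ! i)"
        using d[of "vs ! i" "vs ! p i"] i by (auto intro: less_imp_le)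
    qed
    obtain i where "p i \<noteq> i"
      using \<open>p \<noteq> id\<close> by (auto simp: fun_eq_iff)
    moreover from this have "i \<in> ?I"
      using p by (auto simp: permutes_def)
    \<comment> \<open>A moved index makes the total depth drop strictly, although a permutation only
      reorders the summands.\<close>
    ultimately have "(\<Sum>i\<in>?I. d (vs ! p i)) < (\<Sum>i\<in>?I. d (vs ! i))"
      using le lt by (intro sum_strict_mono_ex1) (auto intro!: bexI[of _ i])
    moreover have "(\<Sum>i\<in>?I. d (vs ! p i)) = (\<Sum>i\<in>?I. d (vs ! i))"
      using sum.permute[OF p, of "\<lambda>i. d (vs ! i)"] by (simp add: o_def)
    ultimately show False by simp
  qed
  have one: "?M v v = 1" if "v \<in> set vs" for v
    using d[OF that, of v] by (auto simp: parent_matrix_def)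
  have "list_det vs ?M = (\<Sum>p | p permutes ?I. signof p * (\<Prod>i\<in>?I. list_mat vs vs ?M $$ (i, p i)))"
    unfolding list_det_def by (rule det_def') simp
  also have "\<dots> = (\<Sum>p | p permutes ?I. if p = id then 1 else 0)"
  proof (rule sum.cong[OF refl], goal_cases)
    case (1 p)
    then have p: "p permutes ?I" by simp
    have "(\<Prod>i\<in>?I. list_mat vs vs ?M $$ (i, p i)) = (\<Prod>i\<in>?I. ?M (vs ! i) (vs ! p i))"
      using permutes_in_image[OF p] by (intro prod.cong) (auto simp: list_mat_def)
    then show ?case
      using zero[OF p] one by (auto simp: sign_id)
  qed
  also have "\<dots> = 1"
    by (simp add: permutes_id finite_permutations)
  finally show ?thesis .
qed

text \<open>The indicator vector of the vertices that never reach a root lies in the kernel.\<close>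

lemma list_det_parent_matrix_not_forest:
  fixes f :: "'a \<Rightarrow> 'a option"
  assumes dist: "distinct vs" and f: "\<And>v w. v \<in> set vs \<Longrightarrow> f v = Some w \<Longrightarrow> w \<in> set vs"
    and "\<not> rooted_forest (set vs) f"
  shows "list_det vs (parent_matrix f) = (0 :: 'c :: idom)"
proof -
  obtain S where S: "S \<subseteq> set vs" "S \<noteq> {}"
      "\<And>v. v \<in> set vs \<Longrightarrow> v \<in> S \<longleftrightarrow> (\<exists>w\<in>S. f v = Some w)"
    by (rule rooted_forest_or_closed[OF _ assms(3)]) (blast intro: f)+
  let ?M = "parent_matrix f :: 'a \<Rightarrow> 'a \<Rightarrow> 'c"
  define x :: "'c vec" where "x = vec (length vs) (\<lambda>i. of_bool (vs ! i \<in> S))"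
  have "list_mat vs vs ?M *\<^sub>v x = 0\<^sub>v (length vs)"
  proof (rule eq_vecI)
    fix i assume "i < dim_vec (0\<^sub>v (length vs) :: 'c vec)"
    then have i: "i < length vs" by simp
    let ?u = "vs ! i"
    have "(list_mat vs vs ?M *\<^sub>v x) $ i = (\<Sum>k = 0..<length vs. ?M ?u (vs ! k) * of_bool (vs ! k \<in> S))"
      using i by (simp add: list_mat_def x_def scalar_prod_def)
    also have "\<dots> = (\<Sum>v\<in>set vs. ?M ?u v * of_bool (v \<in> S))"
      using sum_list_distinct_conv_sum_set[OF dist, of "\<lambda>v. ?M ?u v * of_bool (v \<in> S)"]
      by (simp add: sum_list_sum_nth)
    also have "\<dots> = (\<Sum>v\<in>S. ?M ?u v)"
      using S(1) by (intro sum.mono_neutral_cong_right) auto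
    also have "\<dots> = (\<Sum>v\<in>S. of_bool (?u = v)) - (\<Sum>v\<in>S. of_bool (f ?u = Some v))"
      by (simp add: parent_matrix_def sum_subtractf)
    \<comment> \<open>The two sums count whether \<open>?u\<close> lies in \<open>S\<close> and
      whether its parent does; by the choice of \<open>S\<close> these agree.\<close>
    also have "\<dots> = 0"
    proof -
      have "finite S" using S(1) finite_subset by blast
      then have "(\<Sum>v\<in>S. of_bool (?u = v)) = (of_bool (?u \<in> S) :: 'c)"
          "(\<Sum>v\<in>S. of_bool (f ?u = Some v)) = (of_bool (\<exists>w\<in>S. f ?u = Some w) :: 'c)"
        by (cases "f ?u"; auto simp: of_bool_def)+
      moreover have "?u \<in> S \<longleftrightarrow> (\<exists>w\<in>S. f ?u = Some w)"
        using S(3) i by simp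
      ultimately show ?thesis by simp
    qed
    finally show "(list_mat vs vs ?M *\<^sub>v x) $ i = 0\<^sub>v (length vs) $ i"
      using i by simp
  qed (simp add: x_def)
  moreover have "x \<noteq> 0\<^sub>v (length vs)"
  proof -
    obtain i where "i < length vs" "vs ! i \<in> S"
      using S(1,2) by (metis ex_in_conv in_set_conv_nth subsetD)
    then have "x $ i \<noteq> 0\<^sub>v (length vs) $ i"
      by (simp add: x_def)
    then show ?thesis by metis
  qed
  moreover have "x \<in> carrier_vec (length vs)"
    by (simp add: x_def)
  ultimately show ?thesis
    unfolding list_det_def by (subst det_0_iff_vec_prod_zero) auto
qed

text \<open>Multilinearity in the rows: row \<open>u\<close> is a combination over choices in
  \<open>C u\<close>, and \<open>f\<close> records one choice per row. In the Leibniz formula this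
  is the expansion of a product of sums.\<close>

lemma list_det_multilinear:
  fixes g :: "'a \<Rightarrow> 'b \<Rightarrow> 'a \<Rightarrow> 'c :: comm_ring_1"
  assumes dist: "distinct vs" and fin: "\<And>v. v \<in> set vs \<Longrightarrow> finite (C v)"
  shows "list_det vs (\<lambda>u v. \<Sum>c\<in>C u. k u c * g u c v) =
    (\<Sum>f\<in>PiE (set vs) C. (\<Prod>v\<in>set vs. k v (f v)) * list_det vs (\<lambda>u v. g u (f u) v))"
proof -
  let ?I = "{0..<length vs}"
  let ?P = "{p. p permutes ?I}"
  \<comment> \<open>\<open>idx\<close> recovers positions from vertices, so that products over rows
    run over vertices, the domain of the choice functions.\<close>
  define idx where "idx = the_inv_into ?I (\<lambda>i. vs ! i)"
  have bij: "bij_betw (\<lambda>i. vs ! i) ?I (set vs)"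
    using bij_betw_nth[OF dist, of ?I "set vs"] by (simp add: atLeast0LessThan)
  have idx: "idx (vs ! i) = i" if "i \<in> ?I" for i
    unfolding idx_def by (rule the_inv_into_f_f) (use bij that in \<open>auto simp: bij_betw_def\<close>)
  have reindex: "(\<Prod>i\<in>?I. h i (vs ! i)) = (\<Prod>v\<in>set vs. h (idx v) v)" for h :: "nat \<Rightarrow> 'a \<Rightarrow> 'c"
    by (subst prod.reindex_bij_betw[OF bij, symmetric]) (simp add: idx)
  have leibniz: "list_det vs A = (\<Sum>p\<in>?P. signof p * (\<Prod>v\<in>set vs. A v (vs ! p (idx v))))"
    for A :: "'a \<Rightarrow> 'a \<Rightarrow> 'c"
  proof -
    have "list_det vs A = (\<Sum>p\<in>?P. signof p * (\<Prod>i\<in>?I. list_mat vs vs A $$ (i, p i)))"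
      unfolding list_det_def by (rule det_def') simp
    also have "\<dots> = (\<Sum>p\<in>?P. signof p * (\<Prod>i\<in>?I. A (vs ! i) (vs ! p i)))"
    proof (intro sum.cong refl arg_cong2[of _ _ _ _ "(*)"] prod.cong, goal_cases)
      case (1 p i)
      then show ?case
        using permutes_in_image[of p ?I i] by (simp add: list_mat_def)
    qed
    also have "\<dots> = (\<Sum>p\<in>?P. signof p * (\<Prod>v\<in>set vs. A v (vs ! p (idx v))))"
      by (intro sum.cong refl arg_cong2[of _ _ _ _ "(*)"]) (rule reindex)
    finally show ?thesis .
  qed
  have "list_det vs (\<lambda>u v. \<Sum>c\<in>C u. k u c * g u c v) =
     (\<Sum>p\<in>?P. signof p * (\<Sum>f\<in>PiE (set vs) C. \<Prod>v\<in>set vs. k v (f v) * g v (f v) (vs ! p (idx v))))"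
    unfolding leibniz using fin by (simp add: prod_sum_PiE)
  also have "\<dots> = (\<Sum>p\<in>?P. \<Sum>f\<in>PiE (set vs) C.
      (\<Prod>v\<in>set vs. k v (f v)) * (signof p * (\<Prod>v\<in>set vs. g v (f v) (vs ! p (idx v)))))"
    by (simp add: sum_distrib_left prod.distrib mult_ac)
  also have "\<dots> = (\<Sum>f\<in>PiE (set vs) C. (\<Prod>v\<in>set vs. k v (f v)) * list_det vs (\<lambda>u v. g u (f u) v))"
    unfolding leibniz by (subst sum.swap) (simp add: sum_distrib_left)
  finally show ?thesis .
qed

text \<open>Row \<open>u\<close> is x e_u plus the sum of w(u,j) (e_u - e_j) over j. The first
  summand is the choice \<open>None\<close>, the others are the choices \<open>Some j\<close>; a
  loop weight w(u,u) cancels.\<close>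

lemma forest_expansion:
  fixes x :: "'c :: idom"
  assumes dist: "distinct vs" and V: "set vs = V"
  shows "list_det vs (\<lambda>u v. (if u = v then x + (\<Sum>j\<in>V. w u j) else 0) - w u v) =
    (\<Sum>f | f \<in> parent_functions V \<and> rooted_forest V f. \<Prod>v\<in>V. case f v of None \<Rightarrow> x | Some j \<Rightarrow> w v j)"
proof -
  let ?C = "insert None (Some ` V)"
  let ?k = "\<lambda>v c. case c of None \<Rightarrow> x | Some j \<Rightarrow> w v j"
  let ?g = "\<lambda>u c v. of_bool (u = v) - of_bool (c = Some v) :: 'c"
  have finV: "finite V" using V by auto
  have "list_det vs (\<lambda>u v. (if u = v then x + (\<Sum>j\<in>V. w u j) else 0) - w u v) =
    list_det vs (\<lambda>u v. \<Sum>c\<in>?C. ?k u c * ?g u c v)"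
  proof (rule list_det_cong)
    fix u v assume "u \<in> set vs" "v \<in> set vs"
    then have "v \<in> V" using V by simp
    have "(\<Sum>c\<in>?C. ?k u c * ?g u c v) = x * of_bool (u = v) + (\<Sum>j\<in>V. w u j * (of_bool (u = v) - of_bool (j = v)))"
      using finV by (subst sum.insert) (auto simp: sum.reindex)
    also have "(\<Sum>j\<in>V. w u j * (of_bool (u = v) - of_bool (j = v))) =
        (\<Sum>j\<in>V. w u j) * of_bool (u = v) - (\<Sum>j\<in>V. w u j * of_bool (j = v))"
      by (simp add: right_diff_distrib sum_subtractf sum_distrib_right)
    also have "(\<Sum>j\<in>V. w u j * of_bool (j = v)) = w u v"
      using finV \<open>v \<in> V\<close> by (simp add: of_bool_def if_distrib[of "\<lambda>y. _ * y"] cong: if_cong)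
    finally show "(if u = v then x + (\<Sum>j\<in>V. w u j) else 0) - w u v = (\<Sum>c\<in>?C. ?k u c * ?g u c v)"
      by (simp add: algebra_simps)
  qed
  also have "\<dots> = (\<Sum>f\<in>parent_functions V. (\<Prod>v\<in>V. ?k v (f v)) * list_det vs (parent_matrix f))"
    unfolding parent_matrix_def V[symmetric] by (rule list_det_multilinear) (use dist in auto)
  also have "\<dots> = (\<Sum>f\<in>parent_functions V. if rooted_forest V f then \<Prod>v\<in>V. ?k v (f v) else 0)"
  proof (rule sum.cong[OF refl])
    fix f assume f: "f \<in> parent_functions V"
    have "list_det vs (parent_matrix f) = (of_bool (rooted_forest V f) :: 'c)"
    proof (cases "rooted_forest V f")
      case True
      then show ?thesis using list_det_parent_matrix_forest[OF dist] V by simp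
    next
      case False
      then show ?thesis
        using list_det_parent_matrix_not_forest[OF dist, of f] V parent_functionsD[OF f] by simp
    qed
    then show "(\<Prod>v\<in>V. ?k v (f v)) * list_det vs (parent_matrix f) =
        (if rooted_forest V f then \<Prod>v\<in>V. ?k v (f v) else 0)"
      by simp
  qed
  also have "\<dots> = (\<Sum>f | f \<in> parent_functions V \<and> rooted_forest V f. \<Prod>v\<in>V. ?k v (f v))"
    using finV by (subst sum.inter_filter[symmetric]) (auto intro!: finite_PiE)
  finally show ?thesis .
qed

lemma forest_expansion_limit:
  fixes w :: "'a \<Rightarrow> 'a \<Rightarrow> complex"
  assumes dist: "distinct vs" and V: "set vs = V" and "V \<noteq> {}"
  shows "((\<lambda>x. list_det vs (\<lambda>u v. (if u = v then x + (\<Sum>j\<in>V. w u j) else 0) - w u v) / x) \<longlongrightarrow>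
    (\<Sum>f | f \<in> parent_functions V \<and> rooted_forest V f \<and> card {v \<in> V. f v = None} = 1.
      \<Prod>v | v \<in> V \<and> f v \<noteq> None. w v (the (f v)))) (at 0)"
proof -
  have finV: "finite V" using V by auto
  have finP: "finite (parent_functions V)"
    using finV by (intro finite_PiE) auto
  let ?R = "\<lambda>f. card {v \<in> V. f v = None}"
  let ?W = "\<lambda>f. \<Prod>v | v \<in> V \<and> f v \<noteq> None. w v (the (f v))"
  let ?F = "{f. f \<in> parent_functions V \<and> rooted_forest V f}"
  \<comment> \<open>Every forest has a root, so each term is divisible by x and the exponent
    \<open>?R f - 1\<close> below is not truncated.\<close>
  have pos: "?R f \<noteq> 0" if "f \<in> ?F" for f
  proof -
    have f: "f \<in> parent_functions V" "rooted_forest V f"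
      using that by auto
    then obtain v where "v \<in> V" "f v = None"
      using rooted_forest_has_root[of V f] \<open>V \<noteq> {}\<close> parent_functionsD[OF f(1)] by blast
    then have "{v \<in> V. f v = None} \<noteq> {}"
      by blast
    then show ?thesis
      using finV by simp
  qed
  have prod: "(\<Prod>v\<in>V. case f v of None \<Rightarrow> x | Some j \<Rightarrow> w v j) = x ^ ?R f * ?W f" for f x
  proof -
    have "(\<Prod>v\<in>V. case f v of None \<Rightarrow> x | Some j \<Rightarrow> w v j) =
      (\<Prod>v | v \<in> V \<and> f v = None. case f v of None \<Rightarrow> x | Some j \<Rightarrow> w v j) *
      (\<Prod>v | v \<in> V \<and> f v \<noteq> None. case f v of None \<Rightarrow> x | Some j \<Rightarrow> w v j)"
      using finV by (subst prod.union_disjoint[symmetric]) (auto intro!: prod.cong)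
    also have "(\<Prod>v | v \<in> V \<and> f v = None. case f v of None \<Rightarrow> x | Some j \<Rightarrow> w v j) = x ^ ?R f"
      by simp
    also have "(\<Prod>v | v \<in> V \<and> f v \<noteq> None. case f v of None \<Rightarrow> x | Some j \<Rightarrow> w v j) = ?W f"
      by (intro prod.cong) auto
    finally show ?thesis .
  qed
  have "(\<Sum>f\<in>?F. x ^ (?R f - 1) * ?W f) =
      list_det vs (\<lambda>u v. (if u = v then x + (\<Sum>j\<in>V. w u j) else 0) - w u v) / x" if "x \<noteq> 0" for x
    unfolding forest_expansion[OF dist V] sum_divide_distrib prod
  proof (rule sum.cong[OF refl])
    fix f assume "f \<in> ?F"
    from pos[OF this] show "x ^ (?R f - 1) * ?W f = x ^ ?R f * ?W f / x"
      using \<open>x \<noteq> 0\<close> by (cases "?R f") auto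
  qed
  then have ev: "\<forall>\<^sub>F x in at 0. (\<Sum>f\<in>?F. x ^ (?R f - 1) * ?W f) =
      list_det vs (\<lambda>u v. (if u = v then x + (\<Sum>j\<in>V. w u j) else 0) - w u v) / x"
    by (auto simp: eventually_at_filter)
  have "((\<lambda>x. \<Sum>f\<in>?F. x ^ (?R f - 1) * ?W f) \<longlongrightarrow> (\<Sum>f\<in>?F. 0 ^ (?R f - 1) * ?W f)) (at 0)"
    by (intro tendsto_intros)
  \<comment> \<open>Since \<open>0 ^ 0 = 1\<close>, exactly the forests with one root
    survive.\<close>
  also have "(\<Sum>f\<in>?F. 0 ^ (?R f - 1) * ?W f) = (\<Sum>f\<in>?F. if ?R f = 1 then ?W f else 0)"
  proof (rule sum.cong[OF refl])
    fix f assume "f \<in> ?F"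
    from pos[OF this] show "0 ^ (?R f - 1) * ?W f = (if ?R f = 1 then ?W f else 0)"
      by (auto simp: power_0_left)
  qed
  also have "\<dots> = (\<Sum>f | f \<in> parent_functions V \<and> rooted_forest V f \<and> ?R f = 1. ?W f)"
    using finP by (subst sum.inter_filter[symmetric]) (auto intro!: sum.cong)
  finally show ?thesis
    using ev by (rule Lim_transform_eventually)
qed

section \<open>Oriented spanning trees as parent functions\<close>

lemma out_degree_with_proj: "out_degree (with_proj D) v = card {w. (v, w) \<in> parcs D}"
proof -
  have "out_arcs (with_proj D) v = Pair v ` {w. (v, w) \<in> parcs D}"
    by (auto simp: out_arcs_def)
  then show ?thesis
    by (simp add: out_degree_def card_image inj_on_def)
qed

definition parent_tree :: "'a set \<Rightarrow> ('a \<Rightarrow> 'a option) \<Rightarrow> 'a pair_pre_digraph" where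
  "parent_tree V f = \<lparr>pverts = V, parcs = {(v, w). v \<in> V \<and> f v = Some w}\<rparr>"

lemma parent_tree_simps [simp]:
  "pverts (parent_tree V f) = V" "(v, w) \<in> parcs (parent_tree V f) \<longleftrightarrow> v \<in> V \<and> f v = Some w"
  by (simp_all add: parent_tree_def)

lemma mk_symmetric_with_proj [simp]:
  "pverts (mk_symmetric (with_proj T)) = pverts T"
  "(v, w) \<in> parcs (mk_symmetric (with_proj T)) \<longleftrightarrow> (v, w) \<in> parcs T \<or> (w, v) \<in> parcs T"
  by (auto simp: mk_symmetric_def intro: bexI[of _ "(v, w)"] bexI[of _ "(w, v)"])

text \<open>Turns the recursive description of walks into statements about indices; the third one
  makes the distinctness condition on a cycle a condition on the heads of its arcs.\<close>

lemma pcas_chain: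
  assumes "pcas u p v"
  shows "\<And>k. Suc k < length p \<Longrightarrow> fst (p ! Suc k) = snd (p ! k)"
    and "p \<noteq> [] \<Longrightarrow> fst (p ! 0) = u \<and> snd (p ! (length p - 1)) = v"
    and "tl (pawalk_verts u p) = map snd p"
proof -
  have "(\<forall>k. Suc k < length p \<longrightarrow> fst (p ! Suc k) = snd (p ! k)) \<and>
      (p \<noteq> [] \<longrightarrow> fst (p ! 0) = u \<and> snd (p ! (length p - 1)) = v) \<and> pawalk_verts u p = u # map snd p"
    using assms
  proof (induction p arbitrary: u)
    case (Cons e p)
    then have IH: "\<And>k. Suc k < length p \<Longrightarrow> fst (p ! Suc k) = snd (p ! k)"
        "p \<noteq> [] \<Longrightarrow> fst (p ! 0) = snd e \<and> snd (p ! (length p - 1)) = v"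
        "pawalk_verts (snd e) p = snd e # map snd p"
      by auto
    then have "fst ((e # p) ! Suc k) = snd ((e # p) ! k)" if "Suc k < length (e # p)" for k
      using that by (cases k) auto
    then show ?case
      using IH Cons.prems by (auto simp: nth_Cons')
  qed simp
  then show "\<And>k. Suc k < length p \<Longrightarrow> fst (p ! Suc k) = snd (p ! k)"
    and "p \<noteq> [] \<Longrightarrow> fst (p ! 0) = u \<and> snd (p ! (length p - 1)) = v"
    and "tl (pawalk_verts u p) = map snd p"
    by auto
qed

text \<open>A vertex of maximal depth on an undirected cycle would have its parent as both neighbours.\<close>

lemma parent_tree_no_cycle:
  assumes forest: "rooted_forest V f"
  shows "\<not> (\<exists>p. pre_digraph.cycle (with_proj (mk_symmetric (with_proj (parent_tree V f)))) p \<and> length p \<ge> 3)"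
proof
  let ?S = "mk_symmetric (with_proj (parent_tree V f))"
  obtain d :: "'a \<Rightarrow> nat" where d: "\<And>v w. v \<in> V \<Longrightarrow> f v = Some w \<Longrightarrow> d w < d v"
    using forest by (auto simp: rooted_forest_def)
  assume "\<exists>p. pre_digraph.cycle (with_proj ?S) p \<and> length p \<ge> 3"
  then obtain p u where p: "length p \<ge> 3" "set p \<subseteq> parcs ?S" "pcas u p u"
      "distinct (tl (pawalk_verts u p))"
    by (auto simp: pre_digraph.cycle_def pre_digraph.awalk_def cas_with_proj_eq awalk_verts_with_proj_eq)
  then have "p \<noteq> []" by auto
  let ?n = "length p"
  have dist: "distinct (map snd p)"
    using p(4) pcas_chain(3)[OF p(3)] by simp
  have arc: "fst (p ! k) \<in> V \<and> f (fst (p ! k)) = Some (snd (p ! k)) \<or>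
      snd (p ! k) \<in> V \<and> f (snd (p ! k)) = Some (fst (p ! k))" if "k < ?n" for k
  proof -
    obtain a b where ab: "p ! k = (a, b)"
      by fastforce
    then have "(a, b) \<in> parcs ?S"
      using p(2) that by (metis nth_mem subsetD)
    then show ?thesis
      using ab by simp
  qed
  \<comment> \<open>Successor and predecessor of a position, taken cyclically.\<close>
  define nxt where "nxt k = (if Suc k < ?n then Suc k else 0)" for k
  define prv where "prv k = (if k = 0 then ?n - 1 else k - 1)" for k
  have nxt: "nxt k < ?n" "fst (p ! nxt k) = snd (p ! k)" if "k < ?n" for k
  proof -
    show "nxt k < ?n" using that p(1) by (auto simp: nxt_def)
    have "k = ?n - 1" if "\<not> Suc k < ?n" using that \<open>k < ?n\<close> by simp
    then show "fst (p ! nxt k) = snd (p ! k)"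
      using pcas_chain(1,2)[OF p(3)] \<open>p \<noteq> []\<close> by (auto simp: nxt_def)
  qed
  obtain k where k: "k < ?n" "\<And>l. l < ?n \<Longrightarrow> d (snd (p ! l)) \<le> d (snd (p ! k))"
  proof -
    have fin: "finite ((\<lambda>l. d (snd (p ! l))) ` {..<?n})" and ne: "(\<lambda>l. d (snd (p ! l))) ` {..<?n} \<noteq> {}"
      using \<open>p \<noteq> []\<close> by (auto simp: lessThan_empty_iff)
    obtain k where "k < ?n" "d (snd (p ! k)) = Max ((\<lambda>l. d (snd (p ! l))) ` {..<?n})"
      using Max_in[OF fin ne] by auto
    then show ?thesis
      using that[of k] Max_ge[OF fin] by auto
  qed
  \<comment> \<open>Length at least 3 is essential for \<open>prv k \<noteq> nxt k\<close>: on two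
    arcs both neighbours coincide.\<close>
  have prv: "prv k < ?n" "nxt (prv k) = k" "prv k \<noteq> nxt k"
    using k(1) p(1) by (auto simp: prv_def nxt_def)
  \<comment> \<open>The tail of arc \<open>k\<close> is the head of the preceding arc, so maximality
    over heads covers it too.\<close>
  have "d (fst (p ! k)) \<le> d (snd (p ! k))"
    using k(2)[OF prv(1)] nxt(2)[OF prv(1)] prv(2) by simp
  then have "f (snd (p ! k)) = Some (fst (p ! k))"
    using arc[OF k(1)] d by fastforce
  moreover have "f (snd (p ! k)) = Some (snd (p ! nxt k))"
    using arc[OF nxt(1)[OF k(1)]] k(2)[OF nxt(1)[OF k(1)]] d nxt(2)[OF k(1)] by fastforce
  ultimately have "snd (p ! prv k) = snd (p ! nxt k)"
    using nxt(2)[OF prv(1)] prv(2) by simp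
  then show False
    using dist prv(1,3) nxt(1)[OF k(1)] by (auto simp: distinct_conv_nth)
qed

text \<open>Induction on depth: in the symmetric closure each vertex is joined to its parent in both
  directions, and the only vertex without a parent is \<open>r\<close>.\<close>

lemma parent_tree_connected:
  assumes forest: "rooted_forest V f" and r: "r \<in> V"
    and root: "\<And>v. v \<in> V \<Longrightarrow> f v = None \<Longrightarrow> v = r"
    and closed: "\<And>v w. v \<in> V \<Longrightarrow> f v = Some w \<Longrightarrow> w \<in> V"
  shows "Digraph_Component.connected (with_proj (parent_tree V f))"
proof -
  let ?S = "mk_symmetric (with_proj (parent_tree V f))"
  interpret S: pair_wf_digraph ?S
    by unfold_locales (use closed in auto)
  obtain d :: "'a \<Rightarrow> nat" where d: "\<And>v w. v \<in> V \<Longrightarrow> f v = Some w \<Longrightarrow> d w < d v"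
    using forest by (auto simp: rooted_forest_def)
  have "v \<rightarrow>\<^sup>*\<^bsub>with_proj ?S\<^esub> r \<and> r \<rightarrow>\<^sup>*\<^bsub>with_proj ?S\<^esub> v" if "v \<in> V" for v
    using that
  proof (induction "d v" arbitrary: v rule: less_induct)
    case less
    show ?case
    proof (cases "f v")
      case None
      then show ?thesis using root less.prems by simp
    next
      case (Some w)
      then have w: "w \<rightarrow>\<^sup>*\<^bsub>with_proj ?S\<^esub> r" "r \<rightarrow>\<^sup>*\<^bsub>with_proj ?S\<^esub> w"
        using less.hyps[of w] d[OF less.prems] closed[OF less.prems] by auto
      have "(v, w) \<in> parcs ?S" "(w, v) \<in> parcs ?S"
        using Some less.prems by simp_all
      then show ?thesis
        using S.adj_reachable_trans[OF _ w(1)] S.reachable_adj_trans[OF w(2)] by simp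
    qed
  qed
  then show ?thesis
    using r by (auto simp: connected_def strongly_connected_def intro: S.reachable_trans)
qed

text \<open>No arc leaves or enters \<open>S\<close>, so a path of the symmetric closure that starts
  in \<open>S\<close> stays there.\<close>

lemma connected_closed_set:
  assumes conn: "Digraph_Component.connected (with_proj T)" and "v \<in> S" "v \<in> pverts T" "r \<in> pverts T"
    and closed: "\<And>u w. (u, w) \<in> parcs T \<Longrightarrow> u \<in> S \<longleftrightarrow> w \<in> S"
  shows "r \<in> S"
proof -
  let ?E = "parcs (mk_symmetric (with_proj T))"
  have "(v, r) \<in> rtrancl_on (pverts T) ?E"
    using conn assms(3,4) by (auto simp: connected_def strongly_connected_def reachable_def)
  then show ?thesis
    using \<open>v \<in> S\<close>
  proof (induction rule: rtrancl_on_induct)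
    case (step x y)
    then show ?case using closed by auto
  qed simp
qed

section \<open>The bijection between parent functions and oriented spanning trees\<close>

definition tree_functions :: "'a pair_pre_digraph \<Rightarrow> ('a \<Rightarrow> 'a option) set" where
  "tree_functions G = {f \<in> parent_functions (pverts G). rooted_forest (pverts G) f \<and>
     card {v \<in> pverts G. f v = None} = 1 \<and>
     (\<forall>v\<in>pverts G. \<forall>w. f v = Some w \<longrightarrow> (v, w) \<in> parcs G)}"

lemma parent_tree_in_oriented_spanning_trees:
  assumes G: "pair_digraph G" and f: "f \<in> tree_functions G"
  shows "parent_tree (pverts G) f \<in> oriented_spanning_trees G"
proof -
  interpret pair_digraph G by fact
  let ?V = "pverts G"
  let ?T = "parent_tree ?V f"
  have f: "f \<in> parent_functions ?V" "rooted_forest ?V f" "card {v \<in> ?V. f v = None} = 1"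
      "\<And>v w. v \<in> ?V \<Longrightarrow> f v = Some w \<Longrightarrow> (v, w) \<in> parcs G"
    using f by (auto simp: tree_functions_def)
  obtain d :: "'a \<Rightarrow> nat" where d: "\<And>v w. v \<in> ?V \<Longrightarrow> f v = Some w \<Longrightarrow> d w < d v"
    using f(2) by (auto simp: rooted_forest_def)
  note closed = parent_functionsD[OF f(1)]
  from f(3) obtain r where "{v \<in> ?V. f v = None} = {r}"
    by (auto simp: card_1_singleton_iff)
  then have r: "r \<in> ?V" "f r = None" "\<And>v. v \<in> ?V \<Longrightarrow> f v = None \<Longrightarrow> v = r"
    by auto
  interpret T: pair_wf_digraph ?T
    by unfold_locales (use closed in auto)
  have "spanning (with_proj ?T) (with_proj G)"
    unfolding spanning_def subgraph_def compatible_def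
    using f(4) T.wf_digraph wf_digraph by (simp add: subset_iff)
  moreover have "undirected_tree ?T"
    unfolding undirected_tree_def
  proof (intro conjI)
    show "Digraph_Component.connected (with_proj ?T)"
      by (rule parent_tree_connected[OF f(2) r(1,3) closed])
    show "asym (parcs ?T)"
    proof (rule asymI)
      fix v w assume vw: "(v, w) \<in> parcs ?T"
      show "(w, v) \<notin> parcs ?T"
        using vw d[of v w] d[of w v] by auto
    qed
    show "\<nexists>p. pre_digraph.cycle (with_proj (mk_symmetric (with_proj ?T))) p \<and> 3 \<le> length p"
      by (rule parent_tree_no_cycle[OF f(2)])
  qed
  moreover have "out_degree (with_proj ?T) r = 0"
    by (simp add: out_degree_with_proj r(2))
  moreover have "out_degree (with_proj ?T) v = 1" if "v \<in> ?V - {r}" for v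
  proof -
    have "f v \<noteq> None"
      using r(3) that by blast
    then obtain w where "f v = Some w"
      by blast
    then have "{w. (v, w) \<in> parcs ?T} = {w}"
      using that by auto
    then show ?thesis by (simp add: out_degree_with_proj)
  qed
  ultimately show ?thesis
    using r(1) by (auto simp: oriented_spanning_trees_def)
qed

text \<open>The outdegrees determine \<open>f\<close>. That it is a forest follows from
  connectedness: the vertices that never reach a root would form a set closed along arcs in both
  directions, which must then contain the root.\<close>

lemma oriented_spanning_tree_is_parent_tree:
  assumes G: "pair_digraph G" and T: "T \<in> oriented_spanning_trees G"
  obtains f where "f \<in> tree_functions G" "T = parent_tree (pverts G) f"
proof -
  interpret pair_digraph G by fact
  let ?V = "pverts G"
  from T obtain r where sp: "spanning (with_proj T) (with_proj G)"
    and conn: "Digraph_Component.connected (with_proj T)" and r: "r \<in> pverts T"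
    and deg_r: "out_degree (with_proj T) r = 0"
    and deg: "\<And>v. v \<in> pverts T - {r} \<Longrightarrow> out_degree (with_proj T) v = 1"
    by (auto simp: oriented_spanning_trees_def undirected_tree_def)
  have V: "pverts T = ?V" and sub: "parcs T \<subseteq> parcs G"
    using sp by (auto simp: spanning_def subgraph_def)
  \<comment> \<open>Finiteness is what lets outdegree 0 mean that no arc leaves, since
    \<open>card\<close> is 0 on infinite sets as well.\<close>
  have fin: "finite {w. (v, w) \<in> parcs T}" for v
    using finite_subset[OF sub] pair_finite_arcs by (auto intro: finite_subset[OF _ finite_Range] dest: RangeI)
  have no_out: "(r, w) \<notin> parcs T" for w
    using deg_r fin[of r] by (auto simp: out_degree_with_proj)
  have out: "\<exists>!w. (v, w) \<in> parcs T" if "v \<in> ?V" "v \<noteq> r" for v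
  proof -
    have "card {w. (v, w) \<in> parcs T} = 1"
      using deg[of v] that V by (simp add: out_degree_with_proj)
    then obtain w where "{w. (v, w) \<in> parcs T} = {w}"
      by (rule card_1_singletonE)
    then have "(v, u) \<in> parcs T \<longleftrightarrow> u = w" for u
      by blast
    then show ?thesis by simp
  qed
  \<comment> \<open>The value \<open>undefined\<close> outside the vertex set makes \<open>f\<close>
    extensional, as membership in \<open>PiE\<close> demands.\<close>
  define f where "f v = (if v \<in> ?V then if v = r then None else Some (THE w. (v, w) \<in> parcs T)
    else undefined)" for v
  have f: "f v = Some w \<longleftrightarrow> (v, w) \<in> parcs T" if "v \<in> ?V" for v w
  proof (cases "v = r")
    case False
    then show ?thesis
      using that theI'[OF out[OF that False]] out[OF that False] by (auto simp: f_def)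
  qed (use no_out that in \<open>simp add: f_def\<close>)
  have tree: "T = parent_tree ?V f"
  proof -
    have "parcs T = {(v, w). v \<in> ?V \<and> f v = Some w}"
      using f sub by (auto dest: in_arcsD1)
    then show ?thesis using V by (simp add: parent_tree_def)
  qed
  have closed: "w \<in> ?V" if "v \<in> ?V" "f v = Some w" for v w
    using that f sub by (auto dest: in_arcsD2)
  have roots: "{v \<in> ?V. f v = None} = {r}"
    using r V by (auto simp: f_def)
  have "rooted_forest ?V f"
  proof (rule ccontr)
    assume "\<not> rooted_forest ?V f"
    then obtain S where S: "S \<subseteq> ?V" "S \<noteq> {}" "\<And>v. v \<in> ?V \<Longrightarrow> v \<in> S \<longleftrightarrow> (\<exists>w\<in>S. f v = Some w)"
      by (rule rooted_forest_or_closed[rotated]) (blast intro: closed)+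
    obtain v where "v \<in> S" using S(2) by blast
    have "r \<in> S"
    proof (rule connected_closed_set[OF conn \<open>v \<in> S\<close>])
      show "u \<in> S \<longleftrightarrow> w \<in> S" if "(u, w) \<in> parcs T" for u w
      proof -
        have u: "u \<in> ?V"
          using that sub by (auto dest: in_arcsD1)
        then have "f u = Some w"
          using that f by simp
        then show ?thesis
          using S(3)[OF u] by simp
      qed
    qed (use \<open>v \<in> S\<close> S(1) V r in auto)
    moreover have "f r = None"
      using roots by blast
    ultimately show False
      using S(3)[of r] r V by simp
  qed
  moreover have "f \<in> parent_functions ?V"
  proof (rule PiE_I)
    show "f v \<in> insert None (Some ` ?V)" if "v \<in> ?V" for v
      using closed[OF that] by (cases "f v") auto
  qed (simp add: f_def)
  ultimately have "f \<in> tree_functions G"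
    using roots f sub by (auto simp: tree_functions_def)
  then show ?thesis
    using that tree by blast
qed

lemma bij_betw_parent_tree:
  assumes "pair_digraph G"
  shows "bij_betw (parent_tree (pverts G)) (tree_functions G) (oriented_spanning_trees G)"
proof (rule bij_betw_imageI)
  show "inj_on (parent_tree (pverts G)) (tree_functions G)"
  proof (rule inj_onI)
    fix f g assume fg: "f \<in> tree_functions G" "g \<in> tree_functions G"
      and eq: "parent_tree (pverts G) f = parent_tree (pverts G) g"
    have "f v = g v" if "v \<in> pverts G" for v
    proof -
      have "f v = Some w \<longleftrightarrow> g v = Some w" for w
        using arg_cong[OF eq, of "\<lambda>T. (v, w) \<in> parcs T"] that by simp
      then show ?thesis
        by (metis not_Some_eq)
    qed
    then show "f = g"
      using fg by (intro PiE_ext[of f "pverts G" _ g]) (auto simp: tree_functions_def)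
  qed
  show "parent_tree (pverts G) ` tree_functions G = oriented_spanning_trees G"
    using parent_tree_in_oriented_spanning_trees[OF assms]
      oriented_spanning_tree_is_parent_tree[OF assms] by blast
qed

text \<open>The matrix-tree theorem for all roots at once: only forests with a single root survive the limit.\<close>

lemma matrix_tree_limit:
  fixes w :: "'a \<Rightarrow> 'a \<Rightarrow> complex"
  assumes G: "nonempty_digraph G" and vs: "distinct vs" "set vs = pverts G"
    and support: "\<And>u v. (u, v) \<notin> parcs G \<Longrightarrow> w u v = 0"
  shows "((\<lambda>x. list_det vs (\<lambda>u v. (if u = v then x + (\<Sum>j\<in>pverts G. w u j) else 0) - w u v) / x) \<longlongrightarrow>
    (\<Sum>T\<in>oriented_spanning_trees G. \<Prod>(i, j)\<in>parcs T. w i j)) (at 0)"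
proof -
  let ?V = "pverts G"
  let ?W = "\<lambda>f. \<Prod>v | v \<in> ?V \<and> f v \<noteq> None. w v (the (f v))"
  have pd: "pair_digraph G" and ne: "?V \<noteq> {}"
    using G by (auto simp: nonempty_digraph_def)
  have finV: "finite ?V"
    using vs(2) by (metis finite_set)
  have fin: "finite (parent_functions ?V)"
    using finV by (intro finite_PiE) auto
  \<comment> \<open>A function that uses a pair outside \<open>parcs G\<close> has a factor 0 by
    \<open>support\<close>.\<close>
  have "(\<Sum>f | f \<in> parent_functions ?V \<and> rooted_forest ?V f \<and> card {v \<in> ?V. f v = None} = 1. ?W f) =
      (\<Sum>f\<in>tree_functions G. ?W f)"
  proof (rule sum.mono_neutral_right)
    show "finite {f. f \<in> parent_functions ?V \<and> rooted_forest ?V f \<and> card {v \<in> ?V. f v = None} = 1}"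
      by (rule finite_subset[OF _ fin]) auto
    show "\<forall>f\<in>{f. f \<in> parent_functions ?V \<and> rooted_forest ?V f \<and> card {v \<in> ?V. f v = None} = 1} -
        tree_functions G. ?W f = 0"
    proof
      fix f assume "f \<in> {f. f \<in> parent_functions ?V \<and> rooted_forest ?V f \<and> card {v \<in> ?V. f v = None} = 1} -
        tree_functions G"
      then obtain v u where "v \<in> ?V" "f v = Some u" "(v, u) \<notin> parcs G"
        by (auto simp: tree_functions_def)
      then show "?W f = 0"
        using finV support by (intro prod_zero bexI[of _ v]) auto
    qed
  qed (auto simp: tree_functions_def)
  also have "\<dots> = (\<Sum>f\<in>tree_functions G. \<Prod>(i, j)\<in>parcs (parent_tree ?V f). w i j)"
  proof (rule sum.cong[OF refl])
    fix f
    have arcs: "parcs (parent_tree ?V f) = (\<lambda>v. (v, the (f v))) ` {v. v \<in> ?V \<and> f v \<noteq> None}"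
      by (force simp: parent_tree_def)
    show "?W f = (\<Prod>(i, j)\<in>parcs (parent_tree ?V f). w i j)"
      unfolding arcs by (subst prod.reindex) (auto simp: inj_on_def)
  qed
  also have "\<dots> = (\<Sum>T\<in>oriented_spanning_trees G. \<Prod>(i, j)\<in>parcs T. w i j)"
    by (rule sum.reindex_bij_betw[OF bij_betw_parent_tree[OF pd]])
  finally show ?thesis
    using forest_expansion_limit[OF vs ne, of w] by (simp only:)
qed

section \<open>The generalized join\<close>

text \<open>The Laplacian as a function of vertices: the diagonal is recognised by equal vertices
  rather than equal positions, which agrees on distinct lists.\<close>

definition lap :: "'a pair_pre_digraph \<Rightarrow> 'a \<Rightarrow> 'a \<Rightarrow> complex" where
  "lap D u v = (if u = v then of_nat (out_degree (with_proj D) u)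
     else if (u, v) \<in> parcs D then -1 else 0)"

lemma laplacian_mat_conv_list_mat:
  assumes "distinct vs"
  shows "laplacian_mat D vs = list_mat vs vs (lap D)"
  using assms
  by (intro eq_matI) (auto simp: laplacian_mat_def list_mat_def lap_def nth_eq_iff_index_eq)

text \<open>As there are no loops, each arc leaving \<open>u\<close> gives one off-diagonal -1, and
  together they cancel the outdegree.\<close>

lemma sum_lap:
  assumes "pair_digraph D" "u \<in> pverts D"
  shows "(\<Sum>v\<in>pverts D. lap D u v) = 0"
proof -
  interpret pair_digraph D by fact
  have "(u, u) \<notin> parcs D"
    using pair_no_loops[of "(u, u)"] by auto
  have "(\<Sum>v\<in>pverts D. lap D u v) = lap D u u + (\<Sum>v\<in>pverts D - {u}. lap D u v)"
    using pair_finite_verts assms(2) by (simp add: sum.remove)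
  also have "(\<Sum>v\<in>pverts D - {u}. lap D u v) = (\<Sum>v\<in>{v. (u, v) \<in> parcs D}. -1)"
    using pair_finite_verts \<open>(u, u) \<notin> parcs D\<close>
    by (intro sum.mono_neutral_cong_right) (auto simp: lap_def dest: in_arcsD2)
  finally show ?thesis
    by (simp add: lap_def out_degree_with_proj)
qed

text \<open>The partition with a single class is equitable for s I + L, with 1 x 1 quotient
  \<open>s\<close>. The root \<open>\<mu> = 0\<close> contributes the same factor \<open>s\<close>
  to the full determinant, and \<open>s \<noteq> 0\<close> allows cancelling it.\<close>

lemma list_det_shifted_lap:
  assumes D: "pair_digraph D" and vs: "distinct vs" "set vs = pverts D" "vs \<noteq> []"
    and char: "char_poly (laplacian_mat D vs) = (\<Prod>k = 1..card (pverts D). [:- \<mu> k, 1:])"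
    and last: "\<mu> (card (pverts D)) = 0" and "s \<noteq> 0"
  shows "list_det (tl vs) (\<lambda>u v. ((if u = v then s else 0) + lap D u v) - (if hd vs = v then s else 0) - lap D (hd vs) v)
    = (\<Prod>k = 1..card (pverts D) - 1. \<mu> k + s)"
proof -
  let ?m = "card (pverts D)"
  let ?B = "\<lambda>u v. (if u = v then s else 0) + lap D u v"
  let ?C = "list_det (tl vs) (\<lambda>u v. ?B u v - ?B (hd vs) v)"
  have eq: "[hd vs] @ tl vs = vs"
    using vs(3) by simp
  have m: "length vs = ?m" "?m > 0"
    using vs distinct_card by fastforce+
  \<comment> \<open>The representative map is constantly \<open>hd vs\<close>, so the class is the
    whole vertex set; \<open>lap\<close> sums to 0 and only \<open>s\<close> remains.\<close>
  have row: "(\<Sum>v | v \<in> set vs \<and> hd vs = r. ?B u v) = s" if "r = hd vs" "u \<in> set vs" for u r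
  proof -
    have "{v. v \<in> set vs \<and> hd vs = r} = pverts D"
      using that(1) vs(2) by simp
    moreover have "finite (pverts D)" "u \<in> pverts D"
      using vs(2) that(2) by (metis finite_set, simp)
    ultimately show ?thesis
      using sum_lap[OF D, of u] by (simp add: sum.distrib)
  qed
  have "list_det ([hd vs] @ tl vs) ?B = list_det [hd vs] (\<lambda>u r. \<Sum>v | v \<in> set ([hd vs] @ tl vs) \<and> hd vs = r. ?B u v) * ?C"
  proof (rule list_det_equitable)
    fix t r assume "t \<in> set (tl vs)" "r \<in> set [hd vs]"
    then have "t \<in> set vs" "r = hd vs" "hd vs \<in> set vs"
      using vs(3) list.set_sel(2) by auto
    then show "(\<Sum>v | v \<in> set ([hd vs] @ tl vs) \<and> hd vs = r. ?B t v) =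
        (\<Sum>v | v \<in> set ([hd vs] @ tl vs) \<and> hd vs = r. ?B (hd vs) v)"
      unfolding eq by (simp only: row)
  qed (use vs eq in auto)
  then have "list_det vs ?B = s * ?C"
    unfolding eq list_det_singleton using row vs(3) by simp
  moreover have "list_det vs ?B = (\<Prod>k = 1..?m. \<mu> k + s)"
  proof -
    have "list_det vs ?B = (-1) ^ ?m * (\<Prod>k = 1..?m. - \<mu> k - s)"
      using list_det_shift_char_poly[OF vs(1), of s "lap D"] char
      by (simp add: laplacian_mat_conv_list_mat[OF vs(1)] m(1) poly_prod)
    also have "\<dots> = (\<Prod>k = 1..?m. (-1) * (- \<mu> k - s))"
      by (simp only: prod.distrib prod_constant card_atLeastAtMost) simp
    finally show ?thesis
      by (simp add: add.commute)
  qed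
  moreover have "(\<Prod>k = 1..?m. \<mu> k + s) = s * (\<Prod>k = 1..?m - 1. \<mu> k + s)"
  proof -
    have "{1..?m} = insert ?m {1..?m - 1}"
      using m(2) by auto
    then show ?thesis
      using last m(2) by simp
  qed
  ultimately have "s * ?C = s * (\<Prod>k = 1..?m - 1. \<mu> k + s)"
    by simp
  then show ?thesis
    using \<open>s \<noteq> 0\<close> by (simp add: diff_diff_eq)
qed

lemma oriented_spanning_trees_subset:
  "T \<in> oriented_spanning_trees G \<Longrightarrow> parcs T \<subseteq> parcs G"
  by (auto simp: oriented_spanning_trees_def spanning_def subgraph_def)

lemma distinct_concat_map:
  assumes "distinct js" "\<And>i. i \<in> set js \<Longrightarrow> distinct (f i)"
    and "\<And>i j. i \<in> set js \<Longrightarrow> j \<in> set js \<Longrightarrow> i \<noteq> j \<Longrightarrow> set (f i) \<inter> set (f j) = {}"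
  shows "distinct (concat (map f js))"
  using assms
proof (induction js)
  case (Cons i js)
  then have "distinct (concat (map f js))"
    by simp
  moreover have "set (f i) \<inter> set (f j) = {}" if "j \<in> set js" for j
    using Cons.prems that by (intro Cons.prems(3)) auto
  ultimately show ?case
    using Cons.prems(2) by auto
qed simp

text \<open>For \<open>i \<noteq> j\<close> this counts the arcs from one vertex of block
  \<open>i\<close> into block \<open>j\<close>. It is 0 for \<open>i = j\<close>, because
  \<open>G\<close> has no loops; arcs inside blocks are not counted.\<close>

definition join_weight :: "'a pair_pre_digraph \<Rightarrow> ('a \<Rightarrow> 'b pair_pre_digraph) \<Rightarrow> 'a \<Rightarrow> 'a \<Rightarrow> complex" where
  "join_weight G H i j = of_bool ((i, j) \<in> parcs G) * of_nat (card (pverts (H j)))"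

definition join_arc :: "'a pair_pre_digraph \<Rightarrow> ('a \<Rightarrow> 'b pair_pre_digraph) \<Rightarrow> 'a \<times> 'b \<Rightarrow> 'a \<times> 'b \<Rightarrow> complex" where
  "join_arc G H p q = of_bool ((p, q) \<in> parcs (generalized_join G H))"

text \<open>The representatives of the blocks come first, as \<open>list_det_equitable\<close> requires.\<close>

definition join_list :: "'a list \<Rightarrow> ('a \<Rightarrow> 'b list) \<Rightarrow> ('a \<times> 'b) list" where
  "join_list ns vs = map (\<lambda>i. (i, hd (vs i))) ns @ concat (map (\<lambda>i. map (Pair i) (tl (vs i))) ns)"

context
  fixes G :: "'a pair_pre_digraph" and H :: "'a \<Rightarrow> 'b pair_pre_digraph"
  assumes G: "nonempty_digraph G" and H: "\<And>i. i \<in> pverts G \<Longrightarrow> nonempty_digraph (H i)"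
begin

lemma parcs_generalized_join:
  "((i, u), (j, v)) \<in> parcs (generalized_join G H) \<longleftrightarrow>
    i \<in> pverts G \<and> j \<in> pverts G \<and>
    (if i = j then (u, v) \<in> parcs (H i)
     else u \<in> pverts (H i) \<and> v \<in> pverts (H j) \<and> (i, j) \<in> parcs G)"
  by (auto simp: generalized_join_def)

lemma pverts_generalized_join: "pverts (generalized_join G H) = Sigma (pverts G) (\<lambda>i. pverts (H i))"
  by (simp add: generalized_join_def)

lemma finite_pverts: "finite (pverts G)" "i \<in> pverts G \<Longrightarrow> finite (pverts (H i))"
  using G H by (auto simp: nonempty_digraph_def pair_digraph_def pair_fin_digraph_def
      pair_fin_digraph_axioms_def)

lemma nonempty_digraph_generalized_join: "nonempty_digraph (generalized_join G H)"
proof -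
  interpret G: pair_digraph G
    using G by (simp add: nonempty_digraph_def)
  have Hi: "pair_digraph (H i)" "pverts (H i) \<noteq> {}" if "i \<in> pverts G" for i
    using H[OF that] by (simp_all add: nonempty_digraph_def)
  have wf: "p \<in> pverts (generalized_join G H) \<and> q \<in> pverts (generalized_join G H) \<and> p \<noteq> q"
    if "(p, q) \<in> parcs (generalized_join G H)" for p q
  proof -
    obtain i u j v where pq: "p = (i, u)" "q = (j, v)"
      by (cases p, cases q) auto
    have ij: "i \<in> pverts G" "j \<in> pverts G"
      using that by (simp_all add: pq parcs_generalized_join)
    show ?thesis
    proof (cases "i = j")
      case True
      interpret Hi: pair_digraph "H i" by (rule Hi) (rule ij)
      have uv: "(u, v) \<in> parcs (H i)"
        using that True by (simp add: pq parcs_generalized_join)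
      show ?thesis
        using True ij Hi.in_arcsD1[OF uv] Hi.in_arcsD2[OF uv] Hi.pair_no_loops[OF uv]
        by (simp add: pq pverts_generalized_join)
    next
      case False
      then show ?thesis
        using that by (simp add: pq parcs_generalized_join pverts_generalized_join)
    qed
  qed
  have fin: "finite (pverts (generalized_join G H))"
    unfolding pverts_generalized_join by (intro finite_SigmaI finite_pverts)
  have "parcs (generalized_join G H) \<subseteq> pverts (generalized_join G H) \<times> pverts (generalized_join G H)"
    using wf by auto
  then have "finite (parcs (generalized_join G H))"
    using fin by (meson finite_SigmaI finite_subset)
  then have "pair_digraph (generalized_join G H)"
    using fin wf by unfold_locales auto
  moreover have "pverts (generalized_join G H) \<noteq> {}"
    using G Hi(2) by (fastforce simp: nonempty_digraph_def pverts_generalized_join)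
  ultimately show ?thesis
    by (simp add: nonempty_digraph_def)
qed

lemma sum_join_arc_block:
  assumes "i \<in> pverts G" "j \<in> pverts G" "u \<in> pverts (H i)"
  shows "(\<Sum>v\<in>pverts (H j). join_arc G H (i, u) (j, v)) =
    (if i = j then of_nat (out_degree (with_proj (H i)) u) else join_weight G H i j)"
proof (cases "i = j")
  case True
  interpret Hi: pair_digraph "H i"
    using H[OF assms(1)] by (simp add: nonempty_digraph_def)
  have "(\<Sum>v\<in>pverts (H i). join_arc G H (i, u) (i, v)) = (\<Sum>v\<in>{v. (u, v) \<in> parcs (H i)}. 1)"
    using assms Hi.pair_finite_verts
    by (intro sum.mono_neutral_cong_right) (auto simp: join_arc_def parcs_generalized_join dest: Hi.in_arcsD2)
  then show ?thesis
    using True by (simp add: out_degree_with_proj)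
next
  case False
  then show ?thesis
    using assms by (simp add: join_arc_def join_weight_def parcs_generalized_join)
qed

lemma join_weight_self: "join_weight G H i i = 0"
  using G by (auto simp: join_weight_def nonempty_digraph_def dest: pair_loopfree_digraph.pair_no_loops[OF pair_digraph.axioms(2)])

text \<open>This is the diagonal of the Laplacian of the join. The second summand is the same for
  all vertices of a block, so a diagonal block is the Laplacian of \<open>H i\<close> shifted by a
  scalar.\<close>

lemma sum_join_arc:
  assumes "i \<in> pverts G" "u \<in> pverts (H i)"
  shows "(\<Sum>q\<in>pverts (generalized_join G H). join_arc G H (i, u) q) =
    of_nat (out_degree (with_proj (H i)) u) + (\<Sum>j\<in>pverts G. join_weight G H i j)"
proof -
  have "(\<Sum>q\<in>pverts (generalized_join G H). join_arc G H (i, u) q) =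
      (\<Sum>j\<in>pverts G. \<Sum>v\<in>pverts (H j). join_arc G H (i, u) (j, v))"
    unfolding pverts_generalized_join by (subst sum.Sigma) (auto intro: finite_pverts)
  also have "\<dots> = (\<Sum>j\<in>pverts G. (if i = j then of_nat (out_degree (with_proj (H i)) u) else 0) + join_weight G H i j)"
    by (intro sum.cong refl) (use assms in \<open>simp add: sum_join_arc_block join_weight_self\<close>)
  also have "\<dots> = of_nat (out_degree (with_proj (H i)) u) + (\<Sum>j\<in>pverts G. join_weight G H i j)"
    using assms finite_pverts(1) by (simp add: sum.distrib)
  finally show ?thesis .
qed

lemma join_list_enumerates:
  assumes ns: "distinct ns" "set ns = pverts G"
    and vs: "\<And>i. i \<in> pverts G \<Longrightarrow> distinct (vs i) \<and> set (vs i) = pverts (H i)"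
  shows "distinct (join_list ns vs)" "set (join_list ns vs) = pverts (generalized_join G H)"
proof -
  have hd_tl: "hd (vs i) \<notin> set (tl (vs i))" "distinct (tl (vs i))"
      "insert (hd (vs i)) (set (tl (vs i))) = pverts (H i)" if "i \<in> pverts G" for i
    using vs[OF that] H[OF that] by (cases "vs i"; auto simp: nonempty_digraph_def)+
  show "distinct (join_list ns vs)"
    unfolding join_list_def distinct_append
  proof (intro conjI)
    show "distinct (concat (map (\<lambda>i. map (Pair i) (tl (vs i))) ns))"
      using ns hd_tl(2) by (intro distinct_concat_map) (auto simp: distinct_map inj_on_def)
  qed (use ns hd_tl(1) in \<open>auto simp: distinct_map inj_on_def\<close>)
  show "set (join_list ns vs) = pverts (generalized_join G H)"
    unfolding join_list_def pverts_generalized_join using hd_tl(3) ns(2) by (fastforce simp: set_eq_iff)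
qed

lemma list_det_generalized_join:
  fixes x :: complex
  assumes ns: "distinct ns" "set ns = pverts G"
    and vs: "\<And>i. i \<in> pverts G \<Longrightarrow> distinct (vs i) \<and> set (vs i) = pverts (H i)"
    and char: "\<And>i. i \<in> pverts G \<Longrightarrow>
      char_poly (laplacian_mat (H i) (vs i)) = (\<Prod>k = 1..card (pverts (H i)). [:- \<mu> i k, 1:])"
    and last: "\<And>i. i \<in> pverts G \<Longrightarrow> \<mu> i (card (pverts (H i))) = 0"
    and nz: "\<And>i. i \<in> pverts G \<Longrightarrow> x + (\<Sum>j\<in>pverts G. join_weight G H i j) \<noteq> 0"
  shows "list_det (join_list ns vs)
      (\<lambda>p q. (if p = q then x + (\<Sum>r\<in>pverts (generalized_join G H). join_arc G H p r) else 0) - join_arc G H p q) =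
    list_det ns (\<lambda>i j. (if i = j then x + (\<Sum>k\<in>pverts G. join_weight G H i k) else 0) - join_weight G H i j) *
    (\<Prod>i\<in>pverts G. \<Prod>k = 1..card (pverts (H i)) - 1. \<mu> i k + (x + (\<Sum>j\<in>pverts G. join_weight G H i j)))"
proof -
  let ?V = "pverts G"
  let ?rs = "map (\<lambda>i. (i, hd (vs i))) ns"
  let ?ts = "concat (map (\<lambda>i. map (Pair i) (tl (vs i))) ns)"
  let ?s = "\<lambda>i. x + (\<Sum>j\<in>?V. join_weight G H i j)"
  let ?J = "generalized_join G H"
  let ?Q = "\<lambda>i j. (if i = j then ?s i else 0) - join_weight G H i j"
  define M where "M = (\<lambda>p q. (if p = q then x + (\<Sum>r\<in>pverts ?J. join_arc G H p r) else 0) - join_arc G H p q)"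
  define \<rho> where "\<rho> = (\<lambda>p :: 'a \<times> 'b. (fst p, hd (vs (fst p))))"
  have H': "pair_digraph (H i)" "pverts (H i) \<noteq> {}" if "i \<in> ?V" for i
    using H[OF that] by (simp_all add: nonempty_digraph_def)
  have vs': "distinct (vs i)" "set (vs i) = pverts (H i)" "vs i \<noteq> []" "hd (vs i) \<in> pverts (H i)"
      "set (tl (vs i)) \<subseteq> pverts (H i)"
    if "i \<in> ?V" for i
    using vs[OF that] H'(2)[OF that] by (cases "vs i"; auto)+
  have set_all: "set (?rs @ ?ts) = pverts ?J" and dist: "distinct (?rs @ ?ts)"
    using join_list_enumerates[OF ns vs] unfolding join_list_def by blast+
  have M_block: "M (i, u) (i, v) = (if u = v then ?s i else 0) + lap (H i) u v"
    if "i \<in> ?V" "u \<in> pverts (H i)" for i u v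
  proof -
    have "(u, u) \<notin> parcs (H i)"
      using pair_loopfree_digraph.pair_no_loops[OF pair_digraph.axioms(2)[OF H'(1)[OF that(1)]], of "(u, u)"]
      by auto
    moreover have "join_arc G H (i, u) (i, v) = of_bool ((u, v) \<in> parcs (H i))"
      using that by (simp add: join_arc_def parcs_generalized_join)
    ultimately show ?thesis
      using that by (auto simp: M_def sum_join_arc lap_def)
  qed
  have M_off: "M (i, u) (j, v) = - of_bool ((i, j) \<in> parcs G)"
    if "i \<noteq> j" "i \<in> ?V" "j \<in> ?V" "u \<in> pverts (H i)" "v \<in> pverts (H j)" for i j u v
    using that by (simp add: M_def join_arc_def parcs_generalized_join)
  \<comment> \<open>The row sum over a block does not depend on \<open>u\<close>: off the diagonal
    the block is constant, and on it the Laplacian of \<open>H i\<close> sums to 0. This gives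
    equitability and the quotient at once.\<close>
  have quotient: "(\<Sum>q | q \<in> set (?rs @ ?ts) \<and> \<rho> q = (j, hd (vs j)). M (i, u) q) = ?Q i j"
    if "i \<in> ?V" "j \<in> ?V" "u \<in> pverts (H i)" for i j u
  proof -
    have "{q. q \<in> set (?rs @ ?ts) \<and> \<rho> q = (j, hd (vs j))} = Pair j ` pverts (H j)"
      unfolding set_all using that(2) by (auto simp: pverts_generalized_join \<rho>_def)
    then have "(\<Sum>q | q \<in> set (?rs @ ?ts) \<and> \<rho> q = (j, hd (vs j)). M (i, u) q) =
        (\<Sum>v\<in>pverts (H j). M (i, u) (j, v))"
      by (simp add: sum.reindex inj_on_def)
    also have "\<dots> = ?Q i j"
    proof (cases "i = j")
      case True
      have "(\<Sum>v\<in>pverts (H i). M (i, u) (i, v)) = ?s i + (\<Sum>v\<in>pverts (H i). lap (H i) u v)"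
        using that finite_pverts(2) by (simp add: M_block sum.distrib)
      then show ?thesis
        using True that sum_lap[OF H'(1)] by (simp add: join_weight_self)
    next
      case False
      then show ?thesis
        using that by (simp add: M_off join_weight_def)
    qed
    finally show ?thesis .
  qed
  have "list_det (?rs @ ?ts) M =
    list_det ?rs (\<lambda>p r. \<Sum>q | q \<in> set (?rs @ ?ts) \<and> \<rho> q = r. M p q) *
    list_det ?ts (\<lambda>p q. M p q - M (\<rho> p) q)"
  proof (rule list_det_equitable)
    show "distinct (?rs @ ?ts)"
      by (rule dist)
    show "\<rho> p \<in> set ?rs" if "p \<in> set ?ts" for p
      using that by (auto simp: \<rho>_def)
    show "\<rho> p = p" if "p \<in> set ?rs" for p
      using that by (auto simp: \<rho>_def)
    fix p r assume "p \<in> set ?ts" "r \<in> set ?rs"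
    then obtain i u j where "p = (i, u)" "i \<in> ?V" "u \<in> pverts (H i)" "r = (j, hd (vs j))" "j \<in> ?V"
      using ns(2) vs'(5) by fastforce
    then show "(\<Sum>q | q \<in> set (?rs @ ?ts) \<and> \<rho> q = r. M p q) =
        (\<Sum>q | q \<in> set (?rs @ ?ts) \<and> \<rho> q = r. M (\<rho> p) q)"
      using quotient vs'(4) by (simp add: \<rho>_def del: set_append)
  qed
  also have "list_det ?rs (\<lambda>p r. \<Sum>q | q \<in> set (?rs @ ?ts) \<and> \<rho> q = r. M p q) = list_det ns ?Q"
    unfolding list_det_map by (rule list_det_cong) (use ns(2) quotient vs'(4) in \<open>simp del: set_append\<close>)
  \<comment> \<open>By \<open>M_off\<close>, off-diagonal blocks are constant; subtracting the
    representative's row kills them and leaves a block diagonal matrix.\<close>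
  also have "list_det ?ts (\<lambda>p q. M p q - M (\<rho> p) q) =
      (\<Prod>i\<in>set ns. list_det (map (Pair i) (tl (vs i))) (\<lambda>p q. M p q - M (\<rho> p) q))"
  proof (rule list_det_concat[OF ns(1)])
    fix i j p q assume "i \<in> set ns" "j \<in> set ns" "i \<noteq> j"
      "p \<in> set (map (Pair i) (tl (vs i)))" "q \<in> set (map (Pair j) (tl (vs j)))"
    then show "M p q - M (\<rho> p) q = 0"
      using vs'(4,5) ns(2) by (auto simp: \<rho>_def M_off subset_iff)
  qed
  also have "\<dots> = (\<Prod>i\<in>?V. \<Prod>k = 1..card (pverts (H i)) - 1. \<mu> i k + ?s i)"
    unfolding ns(2)
  proof (rule prod.cong[OF refl])
    fix i assume i: "i \<in> ?V"
    have "list_det (map (Pair i) (tl (vs i))) (\<lambda>p q. M p q - M (\<rho> p) q) =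
      list_det (tl (vs i)) (\<lambda>u v. ((if u = v then ?s i else 0) + lap (H i) u v) -
        (if hd (vs i) = v then ?s i else 0) - lap (H i) (hd (vs i)) v)"
      unfolding list_det_map
      by (rule list_det_cong) (use i vs'(4,5) in \<open>auto simp: M_block \<rho>_def subset_iff\<close>)
    also have "\<dots> = (\<Prod>k = 1..card (pverts (H i)) - 1. \<mu> i k + ?s i)"
      by (rule list_det_shifted_lap[OF H'(1)[OF i] vs'(1-3)[OF i] char[OF i] last[OF i] nz[OF i]])
    finally show "list_det (map (Pair i) (tl (vs i))) (\<lambda>p q. M p q - M (\<rho> p) q) =
        (\<Prod>k = 1..card (pverts (H i)) - 1. \<mu> i k + ?s i)" .
  qed
  finally show ?thesis
    unfolding M_def join_list_def .
qed

end

theorem theorem3p5: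
  fixes n :: nat
    and G :: "nat pair_pre_digraph"
    and H :: "nat \<Rightarrow> 'b pair_pre_digraph"
    and m :: "nat \<Rightarrow> nat"
    and \<mu> :: "nat \<Rightarrow> nat \<Rightarrow> complex"
  assumes G: "nonempty_digraph G" "pverts G = {1..n}"
    and H: "\<And>i. i \<in> {1..n} \<Longrightarrow> nonempty_digraph (H i)"
    and m: "\<And>i. i \<in> {1..n} \<Longrightarrow> m i = card (pverts (H i))"
    and eigenvalues: "\<And>i. i \<in> {1..n} \<Longrightarrow> laplacian_eigenvalues (H i) (\<mu> i)"
    and last_eigenvalue: "\<And>i. i \<in> {1..n} \<Longrightarrow> \<mu> i (m i) = 0"
  shows "complex_of_nat (num_oriented_spanning_trees (generalized_join G H)) =
    (\<Prod>i \<in> pverts G. \<Prod>k = 1..m i - 1. (\<mu> i k + (\<Sum>j | (i, j) \<in> parcs G. complex_of_nat (m j)))) *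
    (\<Sum>T \<in> oriented_spanning_trees G. \<Prod>(i, j) \<in> parcs T. complex_of_nat (m j))"
proof -
  let ?J = "generalized_join G H"
  let ?d = "\<lambda>i. \<Sum>j\<in>pverts G. join_weight G H i j"
  let ?P = "\<lambda>x. \<Prod>i\<in>pverts G. \<Prod>k = 1..m i - 1. \<mu> i k + (x + ?d i)"
  let ?S = "\<Sum>T\<in>oriented_spanning_trees G. \<Prod>(i, j)\<in>parcs T. join_weight G H i j"
  interpret G: pair_digraph G
    using G by (simp add: nonempty_digraph_def)
  have H': "nonempty_digraph (H i)" if "i \<in> pverts G" for i
    using H that G(2) by simp
  note J = nonempty_digraph_generalized_join[OF G(1) H']
  have "\<forall>i\<in>pverts G. \<exists>v. distinct v \<and> set v = pverts (H i) \<and>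
      char_poly (laplacian_mat (H i) v) = (\<Prod>k = 1..card (pverts (H i)). [:- \<mu> i k, 1:])"
    using eigenvalues G(2) by (simp add: laplacian_eigenvalues_def)
  from bchoice[OF this] obtain vs where vs: "\<And>i. i \<in> pverts G \<Longrightarrow> distinct (vs i) \<and> set (vs i) = pverts (H i)"
    and char: "\<And>i. i \<in> pverts G \<Longrightarrow>
      char_poly (laplacian_mat (H i) (vs i)) = (\<Prod>k = 1..card (pverts (H i)). [:- \<mu> i k, 1:])"
    by blast
  have last: "\<mu> i (card (pverts (H i))) = 0" if "i \<in> pverts G" for i
    using that last_eigenvalue[of i] m[of i] G(2) by simp
  define ns where "ns = [1..<Suc n]"
  have ns: "distinct ns" "set ns = pverts G"
    by (simp_all add: ns_def G(2) atLeastLessThanSuc_atLeastAtMost del: upt_Suc)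
  let ?F = "\<lambda>x. list_det (join_list ns vs)
    (\<lambda>p q. (if p = q then x + (\<Sum>r\<in>pverts ?J. join_arc G H p r) else 0) - join_arc G H p q)"
  let ?Q = "\<lambda>x. list_det ns (\<lambda>i j. (if i = j then x + ?d i else 0) - join_weight G H i j)"
  have "((\<lambda>x. ?F x / x) \<longlongrightarrow>
      (\<Sum>T\<in>oriented_spanning_trees ?J. \<Prod>(p, q)\<in>parcs T. join_arc G H p q)) (at 0)"
    by (rule matrix_tree_limit[OF J join_list_enumerates[OF G(1) H' ns vs]]) (simp_all add: join_arc_def)
  \<comment> \<open>Every arc of a spanning tree is an arc of the join and has weight 1, so the
    weighted sum is a count.\<close>
  also have "(\<Sum>T\<in>oriented_spanning_trees ?J. \<Prod>(p, q)\<in>parcs T. join_arc G H p q) =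
      (\<Sum>T\<in>oriented_spanning_trees ?J. 1)"
    by (intro sum.cong refl prod.neutral)
      (auto simp: join_arc_def dest: oriented_spanning_trees_subset)
  finally have lim1: "((\<lambda>x. ?F x / x) \<longlongrightarrow> of_nat (num_oriented_spanning_trees ?J)) (at 0)"
    by (simp add: num_oriented_spanning_trees_def)
  have "((\<lambda>x. ?Q x / x) \<longlongrightarrow> ?S) (at 0)"
    by (rule matrix_tree_limit[OF G(1) ns]) (simp add: join_weight_def)
  then have lim2: "((\<lambda>x. ?Q x / x * ?P x) \<longlongrightarrow> ?S * ?P 0) (at 0)"
    by (intro tendsto_intros)
  \<comment> \<open>Only finitely many values have to be avoided for the block factors to be valid;
    if \<open>?d i = 0\<close>, the value is 0 itself, which the punctured neighbourhood
    excludes.\<close>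
  have "\<forall>\<^sub>F x in at 0. \<forall>i\<in>pverts G. x \<noteq> - ?d i"
    by (intro eventually_ball_finite G.pair_finite_verts ballI eventually_neq_at_within)
  then have "\<forall>\<^sub>F x in at 0. ?Q x / x * ?P x = ?F x / x"
  proof eventually_elim
    case (elim x)
    have "?F x = ?Q x * (\<Prod>i\<in>pverts G. \<Prod>k = 1..card (pverts (H i)) - 1. \<mu> i k + (x + ?d i))"
      using elim by (intro list_det_generalized_join[OF G(1) H' ns vs char last])
        (auto simp: add_eq_0_iff2)
    also have "(\<Prod>i\<in>pverts G. \<Prod>k = 1..card (pverts (H i)) - 1. \<mu> i k + (x + ?d i)) = ?P x"
      using m G(2) by (intro prod.cong) auto
    finally show ?case by simp
  qed
  from Lim_transform_eventually[OF lim2 this]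
  have "of_nat (num_oriented_spanning_trees ?J) = ?S * ?P 0"
    by (rule tendsto_unique[OF at_neq_bot lim1])
  also have "?S = (\<Sum>T\<in>oriented_spanning_trees G. \<Prod>(i, j)\<in>parcs T. of_nat (m j))"
  proof (intro sum.cong refl prod.cong, goal_cases)
    case (1 T e)
    obtain i j where e: "e = (i, j)"
      by (cases e)
    with 1 have "(i, j) \<in> parcs G"
      using oriented_spanning_trees_subset by blast
    then show ?case
      using m G(2) G.in_arcsD2[of i j] by (simp add: e join_weight_def)
  qed
  also have "?P 0 = (\<Prod>i\<in>pverts G. \<Prod>k = 1..m i - 1. \<mu> i k + (\<Sum>j | (i, j) \<in> parcs G. of_nat (m j)))"
  proof -
    have "?d i = (\<Sum>j | (i, j) \<in> parcs G. of_nat (m j))" for i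
      using m G(2) G.pair_finite_verts
      by (intro sum.mono_neutral_cong_right) (auto simp: join_weight_def dest: G.in_arcsD2)
    then show ?thesis by simp
  qed
  finally show ?thesis
    by (simp only: mult.commute)
qed

end
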